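(* Let $G$ be a Polish group. For every Borel, measure-preserving, suitable action of $G$ on a standard probability space $(X,\mu)$ and for every dense subgroup $H\subset G$, the orbit full group $[\mathcal R_H]$ is dense in $[\mathcal R_G]$ for the topology of convergence in measure on $[\mathcal R_G]$.
   Context: A standard probability space $(X,\mu)$ is a standard Borel space $X$ with a non-atomic Borel probability measure $\mu$. A (Borel) measure-preserving action of a Polish group $G$ on $(X,\mu)$ is a group action whose action map $G\times X\to X$ is Borel and such that $\mu(gA)=\mu(A)$ for every $g\in G$ and every Borel $A\subseteq X$. $\mathrm{Aut}(X,\mu)$ is the group of measure-preserving Borel bijections of $(X,\mu)$, two of them being identified if they coincide on a full measure set. Suitable: a Borel measure-preserving action of $G$ on $(X,\mu)$ is suitable if for all Borel subsets $A,B\subset X$ of positive measure, one of the following two conditions holds: (1) for any open neighborhood of the identity $O\subset G$, there is $g\in O$ such that $\mu(A\cap gB)>0$; (2) there are Borel subsets $A'\subset A$ and $B'\subset B$ of full measure in $A$ and $B$ respectively and an open neighborhood $O$ of the identity in $G$ such that $(OA')\cap B'=\emptyset$. Orbit full groups: for a subgroup $H\le G$ (in particular $H=G$), $[\mathcal R_H]:=\{T\in\mathrm{Aut}(X,\mu): T(x)\in H\cdot x \text{ for every } x\in X\}$ (up to null sets). Topology of convergence in measure on $[\mathcal R_G]$: let $d_G$ be a compatible, right-invariant, bounded metric on $G$, let $\mathrm L^0(X,\mu,G)$ be the space of measurable functions $X\to G$ (up to equality a.e.), with the metric $\tilde d_G(f,g)=\int_X d_G(f(x),g(x))\,d\mu(x)$;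 its topology only depends on the topology of $G$. For $f\in \mathrm L^0(X,\mu,G)$ let $\Phi(f)(x)=f(x)x$, and let $\widetilde{[\mathcal R_G]}:=\Phi^{-1}([\mathcal R_G])$ with the topology induced from $\mathrm L^0(X,\mu,G)$. The topology of convergence in measure on $[\mathcal R_G]$ is the quotient topology induced by $\Phi:\widetilde{[\mathcal R_G]}\to[\mathcal R_G]$; it is a Polish group topology. *)

theory Defs
  imports "HOL-Probability.Probability"
begin

text \<open>
  A Polish group is a type of sort \<open>{polish_space, topological_group_add}\<close>. The class
  \<open>group_add\<close> is not commutative: the group law is written \<open>+\<close>, the identity \<open>0\<close> and
  the inverse \<open>-\<close>. The complete metric \<open>dist\<close> that comes with \<open>polish_space\<close> is only used
  through its topology.

  A standard Borel space is a type of class \<open>polish_space\<close> with its Borel sets.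
\<close>

definition standard_probability_space :: "'x::polish_space measure \<Rightarrow> bool" where
  "standard_probability_space M \<longleftrightarrow>
     prob_space M \<and> sets M = sets borel \<and>
     (\<forall>A\<in>sets M. emeasure M A > 0 \<longrightarrow>
        (\<exists>B\<in>sets M. B \<subseteq> A \<and> 0 < emeasure M B \<and> emeasure M B < emeasure M A))"

definition mp_borel_action ::
  "'x::polish_space measure \<Rightarrow> ('g::{polish_space, topological_group_add} \<Rightarrow> 'x \<Rightarrow> 'x) \<Rightarrow> bool"
where
  "mp_borel_action M act \<longleftrightarrow>
     (\<forall>x. act 0 x = x) \<and>
     (\<forall>g h x. act (g + h) x = act g (act h x)) \<and>
     (\<lambda>(g, x). act g x) \<in> measurable (borel \<Otimes>\<^sub>M M) M \<and>
     (\<forall>g. \<forall>A\<in>sets M. emeasure M (act g ` A) = emeasure M A)"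

definition suitable ::
  "'x::polish_space measure \<Rightarrow> ('g::{polish_space, topological_group_add} \<Rightarrow> 'x \<Rightarrow> 'x) \<Rightarrow> bool"
where
  "suitable M act \<longleftrightarrow>
     (\<forall>A\<in>sets M. \<forall>B\<in>sets M. emeasure M A > 0 \<longrightarrow> emeasure M B > 0 \<longrightarrow>
        (\<forall>V. open V \<and> 0 \<in> V \<longrightarrow> (\<exists>g\<in>V. emeasure M (A \<inter> act g ` B) > 0)) \<or>
        (\<exists>A'\<in>sets M. \<exists>B'\<in>sets M. \<exists>V.
           A' \<subseteq> A \<and> emeasure M (A - A') = 0 \<and>
           B' \<subseteq> B \<and> emeasure M (B - B') = 0 \<and>
           open V \<and> 0 \<in> V \<and> (\<Union>g\<in>V. act g ` A') \<inter> B' = {}))"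

definition is_subgroup :: "'g::group_add set \<Rightarrow> bool" where
  "is_subgroup H \<longleftrightarrow> 0 \<in> H \<and> (\<forall>g\<in>H. \<forall>h\<in>H. g + h \<in> H) \<and> (\<forall>g\<in>H. - g \<in> H)"

definition ae_class :: "'x measure \<Rightarrow> 'y measure \<Rightarrow> ('x \<Rightarrow> 'y) \<Rightarrow> ('x \<Rightarrow> 'y) set" where
  "ae_class M N f = {f' \<in> measurable M N. AE x in M. f' x = f x}"

definition L0 :: "'x measure \<Rightarrow> 'y measure \<Rightarrow> ('x \<Rightarrow> 'y) set set" where
  "L0 M N = ae_class M N ` measurable M N"

definition mp_bijections :: "'x measure \<Rightarrow> ('x \<Rightarrow> 'x) set" where
  "mp_bijections M =
     {T \<in> measurable M M. bij_betw T (space M) (space M) \<and>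
        (\<forall>A\<in>sets M. emeasure M (T -` A \<inter> space M) = emeasure M A)}"

text \<open>
  Elements of \<open>Aut(X,\<mu>)\<close>, and of the orbit full groups, are represented by their almost
  everywhere classes inside \<open>L0 M M\<close>. The orbit condition is imposed at every point on some
  representative.
\<close>

definition Aut :: "'x measure \<Rightarrow> ('x \<Rightarrow> 'x) set set" where
  "Aut M = ae_class M M ` mp_bijections M"

definition orbit_full_group ::
  "'x measure \<Rightarrow> ('g \<Rightarrow> 'x \<Rightarrow> 'x) \<Rightarrow> 'g set \<Rightarrow> ('x \<Rightarrow> 'x) set set"
where
  "orbit_full_group M act H =
     {\<tau> \<in> Aut M. \<exists>T \<in> \<tau> \<inter> mp_bijections M. \<forall>x\<in>space M. T x \<in> {act h x |h. h \<in> H}}"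

definition compatible_right_invariant_bounded_metric ::
  "('g::{topological_space, group_add} \<Rightarrow> 'g \<Rightarrow> real) \<Rightarrow> bool"
where
  "compatible_right_invariant_bounded_metric d \<longleftrightarrow>
     Metric_space UNIV d \<and> Metric_space.mtopology UNIV d = euclidean \<and>
     (\<forall>g h k. d (g + k) (h + k) = d g h) \<and>
     (\<exists>C. \<forall>g h. d g h \<le> C)"

definition L0_dist ::
  "'x measure \<Rightarrow> ('y \<Rightarrow> 'y \<Rightarrow> real) \<Rightarrow> ('x \<Rightarrow> 'y) set \<Rightarrow> ('x \<Rightarrow> 'y) set \<Rightarrow> real"
where
  "L0_dist M d \<phi> \<psi> = (LINT x|M. d ((SOME f. f \<in> \<phi>) x) ((SOME f. f \<in> \<psi>) x))"

definition Phi ::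
  "'x measure \<Rightarrow> ('g \<Rightarrow> 'x \<Rightarrow> 'x) \<Rightarrow> ('x \<Rightarrow> 'g) set \<Rightarrow> ('x \<Rightarrow> 'x) set"
where
  "Phi M act \<phi> = ae_class M M (\<lambda>x. act ((SOME f. f \<in> \<phi>) x) x)"

definition lifted_full_group ::
  "'x measure \<Rightarrow> ('g::topological_space \<Rightarrow> 'x \<Rightarrow> 'x) \<Rightarrow> ('x \<Rightarrow> 'g) set set"
where
  "lifted_full_group M act =
     {\<phi> \<in> L0 M borel. Phi M act \<phi> \<in> orbit_full_group M act UNIV}"

definition lifted_topology ::
  "'x measure \<Rightarrow> ('g::topological_space \<Rightarrow> 'x \<Rightarrow> 'x) \<Rightarrow> ('g \<Rightarrow> 'g \<Rightarrow> real)
     \<Rightarrow> ('x \<Rightarrow> 'g) set topology"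
where
  "lifted_topology M act d =
     subtopology (Metric_space.mtopology (L0 M borel) (L0_dist M d)) (lifted_full_group M act)"

definition convergence_in_measure_topology ::
  "'x measure \<Rightarrow> ('g::topological_space \<Rightarrow> 'x \<Rightarrow> 'x) \<Rightarrow> ('g \<Rightarrow> 'g \<Rightarrow> real)
     \<Rightarrow> ('x \<Rightarrow> 'x) set topology"
where
  "convergence_in_measure_topology M act d =
     topology (\<lambda>U. U \<subseteq> orbit_full_group M act UNIV \<and>
       openin (lifted_topology M act d) {\<phi> \<in> lifted_full_group M act. Phi M act \<phi> \<in> U})"

lemma ae_class_eq:
  assumes "f' \<in> ae_class M N f"
  shows "ae_class M N f' = ae_class M N f"
proof -
  have *: "AE x in M. f' x = f x" using assms by (simp add: ae_class_def)
  have "(AE x in M. k x = f' x) \<longleftrightarrow> (AE x in M. k x = f x)" for k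
    by (rule eventually_subst, use * in eventually_elim) simp
  then show ?thesis by (simp add: ae_class_def)
qed

lemma some_ae_class:
  assumes "f \<in> measurable M N"
  shows "(SOME k. k \<in> ae_class M N f) \<in> measurable M N"
    and "AE x in M. (SOME k. k \<in> ae_class M N f) x = f x"
proof -
  have "f \<in> ae_class M N f" using assms by (simp add: ae_class_def)
  then have "(SOME k. k \<in> ae_class M N f) \<in> ae_class M N f" by (rule someI[of "\<lambda>k. k \<in> ae_class M N f"])
  then show "(SOME k. k \<in> ae_class M N f) \<in> measurable M N"
    and "AE x in M. (SOME k. k \<in> ae_class M N f) x = f x" by (auto simp: ae_class_def)
qed

lemma Phi_ae_class:
  assumes "f \<in> measurable M borel"
  shows "Phi M act (ae_class M borel f) = ae_class M M (\<lambda>x. act (f x) x)"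
proof -
  let ?k = "SOME k. k \<in> ae_class M borel f"
  have "AE x in M. ?k x = f x" by (rule some_ae_class(2)[OF assms])
  then have "(AE x in M. h x = act (?k x) x) \<longleftrightarrow> (AE x in M. h x = act (f x) x)" for h
    by (intro eventually_subst, elim eventually_mono) simp
  then show ?thesis by (simp add: Phi_def ae_class_def)
qed

lemma metric_measurable:
  fixes d :: "'g::second_countable_topology \<Rightarrow> 'g \<Rightarrow> real"
  assumes d: "Metric_space UNIV d" "Metric_space.mtopology UNIV d = euclidean"
    and [measurable]: "f \<in> borel_measurable M" "g \<in> borel_measurable M"
  shows "(\<lambda>x. d (f x) (g x)) \<in> borel_measurable M"
proof -
  interpret Metric_space UNIV d by fact
  have "continuous_on UNIV (\<lambda>p. mdist (metric (UNIV, d)) (fst p) (snd p))"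
    unfolding continuous_map_iff_continuous2[symmetric]
    by (rule continuous_map_mdist) (simp_all add: d(2) continuous_on_fst continuous_on_snd)
  then have "continuous_on UNIV (\<lambda>p. d (fst p) (snd p))" by simp
  then have "(\<lambda>p. d (fst p) (snd p)) \<in> borel_measurable (borel \<Otimes>\<^sub>M borel)"
    by (simp add: borel_prod borel_measurable_continuous_onI)
  from measurable_compose[OF _ this, of "\<lambda>x. (f x, g x)"] show ?thesis by simp
qed

lemma L0_dist_ae_class:
  fixes d :: "'g::second_countable_topology \<Rightarrow> 'g \<Rightarrow> real"
  assumes "Metric_space UNIV d" "Metric_space.mtopology UNIV d = euclidean"
    and f: "f \<in> measurable M borel" and g: "g \<in> measurable M borel"
  shows "L0_dist M d (ae_class M borel f) (ae_class M borel g) = (LINT x|M. d (f x) (g x))"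
  unfolding L0_dist_def
proof (rule integral_cong_AE)
  show "AE x in M. d ((SOME k. k \<in> ae_class M borel f) x) ((SOME k. k \<in> ae_class M borel g) x)
      = d (f x) (g x)"
    using some_ae_class(2)[OF f] some_ae_class(2)[OF g] by eventually_elim simp
next
  show "(\<lambda>x. d (f x) (g x)) \<in> borel_measurable M"
    by (rule metric_measurable) fact+
  show "(\<lambda>x. d ((SOME k. k \<in> ae_class M borel f) x) ((SOME k. k \<in> ae_class M borel g) x))
      \<in> borel_measurable M"
    by (rule metric_measurable[OF assms(1,2) some_ae_class(1)[OF f] some_ae_class(1)[OF g]])
qed

lemma Metric_space_L0:
  fixes d :: "'g::{second_countable_topology, group_add} \<Rightarrow> 'g \<Rightarrow> real"
  assumes M: "prob_space M" and d: "compatible_right_invariant_bounded_metric d"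
  shows "Metric_space (L0 M borel) (L0_dist M d)"
proof -
  interpret prob_space M by fact
  have d': "Metric_space UNIV d" "Metric_space.mtopology UNIV d = euclidean"
    and "\<exists>C. \<forall>g h. d g h \<le> C"
    using d by (auto simp: compatible_right_invariant_bounded_metric_def)
  then obtain C where C: "\<And>g h. d g h \<le> C" by blast
  interpret d: Metric_space UNIV d by fact
  note dist = L0_dist_ae_class[OF d'] and meas = metric_measurable[OF d']
  have int: "integrable M (\<lambda>x. d (f x) (g x))"
    if "f \<in> borel_measurable M" "g \<in> borel_measurable M" for f g
    by (rule integrable_const_bound[where B = C]) (use C meas that in auto)
  show ?thesis
  proof
    fix \<phi> \<psi> show "0 \<le> L0_dist M d \<phi> \<psi>" by (simp add: L0_dist_def)
    show "L0_dist M d \<phi> \<psi> = L0_dist M d \<psi> \<phi>" by (simp add: L0_dist_def d.commute)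
  next
    fix \<phi> \<psi> assume "\<phi> \<in> L0 M (borel :: 'g measure)" "\<psi> \<in> L0 M (borel :: 'g measure)"
    then obtain f g where f: "f \<in> borel_measurable M" "\<phi> = ae_class M borel f"
      and g: "g \<in> borel_measurable M" "\<psi> = ae_class M borel g"
      by (auto simp: L0_def)
    have "L0_dist M d \<phi> \<psi> = 0 \<longleftrightarrow> (AE x in M. d (f x) (g x) = 0)"
      using f g by (simp add: dist integral_nonneg_eq_0_iff_AE int)
    also have "\<dots> \<longleftrightarrow> (AE x in M. f x = g x)" by simp
    also have "\<dots> \<longleftrightarrow> f \<in> ae_class M borel g" using f by (simp add: ae_class_def)
    also have "\<dots> \<longleftrightarrow> \<phi> = \<psi>"
    proof
      assume "f \<in> ae_class M borel g" then show "\<phi> = \<psi>" using f g by (simp add: ae_class_eq)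
    next
      assume "\<phi> = \<psi>"
      moreover have "f \<in> \<phi>" using f by (simp add: ae_class_def)
      ultimately show "f \<in> ae_class M borel g" using g by simp
    qed
    finally show "L0_dist M d \<phi> \<psi> = 0 \<longleftrightarrow> \<phi> = \<psi>" .
  next
    fix \<phi> \<psi> \<eta>
    assume "\<phi> \<in> L0 M (borel :: 'g measure)" "\<psi> \<in> L0 M (borel :: 'g measure)"
      "\<eta> \<in> L0 M (borel :: 'g measure)"
    then obtain f g h where f: "f \<in> borel_measurable M" "\<phi> = ae_class M borel f"
      and g: "g \<in> borel_measurable M" "\<psi> = ae_class M borel g"
      and h: "h \<in> borel_measurable M" "\<eta> = ae_class M borel h"
      by (auto simp: L0_def)
    have "(LINT x|M. d (f x) (h x)) \<le> (LINT x|M. d (f x) (g x) + d (g x) (h x))"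
      using f g h by (intro integral_mono int Bochner_Integration.integrable_add) (auto intro: d.triangle)
    then show "L0_dist M d \<phi> \<eta> \<le> L0_dist M d \<phi> \<psi> + L0_dist M d \<psi> \<eta>"
      using f g h by (simp add: dist int)
  qed
qed

lemma openin_convergence_in_measure_topology:
  "openin (convergence_in_measure_topology M act d) U \<longleftrightarrow>
     U \<subseteq> orbit_full_group M act UNIV \<and>
     openin (lifted_topology M act d) {\<phi> \<in> lifted_full_group M act. Phi M act \<phi> \<in> U}"
proof -
  let ?T = "lifted_topology M act d"
  let ?P = "\<lambda>U. {\<phi> \<in> lifted_full_group M act. Phi M act \<phi> \<in> U}"
  have "?P (S \<inter> S') = ?P S \<inter> ?P S'" for S S' by auto
  moreover have "?P (\<Union>\<K>) = (\<Union>K\<in>\<K>. ?P K)" for \<K> by auto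
  ultimately have "istopology (\<lambda>U. U \<subseteq> orbit_full_group M act UNIV \<and> openin ?T (?P U))"
    unfolding istopology_def by (auto intro!: openin_Int openin_Union)
  then show ?thesis
    unfolding convergence_in_measure_topology_def by (simp add: topology_inverse')
qed

lemma topspace_convergence_in_measure_topology:
  fixes d :: "'g::{second_countable_topology, group_add} \<Rightarrow> 'g \<Rightarrow> real"
  assumes "prob_space M" and "compatible_right_invariant_bounded_metric d"
  shows "topspace (convergence_in_measure_topology M act d) = orbit_full_group M act UNIV"
proof -
  let ?R = "orbit_full_group M act UNIV"
  have "topspace (lifted_topology M act d) = lifted_full_group M act"
    using Metric_space.topspace_mtopology[OF Metric_space_L0[OF assms]]
    by (auto simp: lifted_topology_def lifted_full_group_def)
  moreover have "{\<phi> \<in> lifted_full_group M act. Phi M act \<phi> \<in> ?R} = lifted_full_group M act"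
    by (auto simp: lifted_full_group_def)
  ultimately have "openin (lifted_topology M act d)
      {\<phi> \<in> lifted_full_group M act. Phi M act \<phi> \<in> ?R}"
    using openin_topspace[of "lifted_topology M act d"] by simp
  then have "openin (convergence_in_measure_topology M act d) ?R"
    by (simp add: openin_convergence_in_measure_topology)
  moreover have "topspace (convergence_in_measure_topology M act d) \<subseteq> ?R"
    using openin_topspace[of "convergence_in_measure_topology M act d"]
    unfolding openin_convergence_in_measure_topology by blast
  ultimately show ?thesis by (simp add: openin_subset subset_antisym)
qed

end

theory Submission
  imports Defs
begin

text \<open>
  Density has to be shown at each \<open>T\<close> in the full group of \<open>G\<close>. Measurable selection yields a Borel
  \<open>f\<close> with \<open>T x = act (f x) x\<close> almost everywhere (\<open>orbit_lift\<close>). This is needed for the statement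
  itself, as a class outside the range of \<open>Phi\<close> would be an isolated point. It then suffices to find, for every
  \<open>\<epsilon>\<close>, a Borel \<open>u\<close> with values in a countable dense subgroup \<open>D\<close> of \<open>H\<close> such that \<open>x \<mapsto> act (u x) x\<close> is a
  measure-preserving bijection and \<open>\<integral> d (f x) (u x) < \<epsilon>\<close> (\<open>approximate_by_subgroup\<close>).

  Cut \<open>X\<close> into countably many pieces \<open>A\<close> on each of which \<open>f\<close> stays within \<open>r\<close> of one \<open>h \<in> D\<close>. On \<open>act h ` A\<close>
  the map \<open>T\<close> becomes a bijection onto \<open>B = T ` A\<close>, up to null sets, that moves each point by a group element of length
  less than \<open>r\<close>, the length of \<open>g\<close> being \<open>d g 0\<close>. This bijection is to be replaced by a matching of
  \<open>act h ` A\<close> with \<open>B\<close> that only uses short elements of \<open>D\<close>. Suitability gives Hall's condition for this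
  matching problem. Indeed, if all elements of \<open>D\<close> shorter than \<open>r\<close> move \<open>C\<close> off \<open>F\<close> up to null sets,
  then so do all elements of \<open>G\<close> shorter than \<open>r\<close>, because \<open>g \<mapsto> \<mu>(gC \<inter> F)\<close> is continuous; the first
  alternative of suitability is therefore excluded for the translates of \<open>C\<close>, the second one holds, and
  by Lindelof's theorem one can discard a null set so that no element shorter than \<open>r\<close> maps
  a point of \<open>C\<close> into \<open>F\<close> (\<open>suitable_separation\<close>). In particular \<open>T\<close> does not, whence
  \<open>\<mu>(C) + \<mu>(F) \<le> \<mu>(A)\<close> (\<open>hall_piece\<close>). The continuity is an automatic one: the action is only Borel, and
  Pettis' lemma is applied to the sets of group elements that move a given set little.

  Hall's condition for countably many edges yields a matching up to a small proportion of \<open>A\<close>.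
  Augmenting paths are avoided by relaxing the length bound. Greedy matchings are
  extended successively with bounds \<open>r, (2K+1)r, (2K+1)\<^sup>2r, \<dots>\<close>. If the unmatched part hardly shrinks
  at one stage, then the sets reachable from it by up to \<open>K\<close> alternating steps of the previous matching
  do not meet the unmatched targets, so that Hall's condition makes their measures grow linearly in the
  number of steps; this is absurd for large \<open>K\<close> (\<open>hall_growth\<close>, \<open>almost_perfect_matching\<close>). The number of stages and
  \<open>K\<close> depend only on the tolerated proportion, neither on \<open>r\<close> nor on the piece, hence \<open>r\<close> can be chosen afterwards.

  The matchings of all pieces together form a partial map with small complement. Completing it is
  easy when arbitrary elements of \<open>D\<close> are admitted: after a greedy extension, the \<open>D\<close>-saturation of the
  unmatched points misses the unmatched targets, and comparing its measure
  on both sides shows that the remainder is null (\<open>complete_matching\<close>).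
\<close>

section \<open>Measurable selection\<close>

text \<open>
  The projections of closed subsets of \<open>Y \<times> \<nat>\<^sup>\<nat>\<close> are the analytic subsets of \<open>Y\<close>. The type
  \<open>nat discrete\<close> carries the discrete metric and is Polish, so that the Baire space is Polish too.
\<close>
definition closed_projection :: "'y::topological_space set \<Rightarrow> bool" where
  "closed_projection R \<longleftrightarrow> (\<exists>F :: ('y \<times> (nat \<Rightarrow> nat discrete)) set. closed F \<and> fst ` F = R)"

lemma closed_discrete: "closed (S :: 'a discrete set)"
  by (simp add: closed_def open_discrete)

lemma closed_projection_closed: "closed_projection R" if "closed R"
  unfolding closed_projection_def
  by (rule exI[of _ "R \<times> UNIV"]) (auto simp: that intro!: closed_Times)

text \<open>
  The first coordinate of a sequence selects the member of the union, the others witness membership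
  in it.
\<close>
lemma closed_projection_UN:
  fixes R :: "nat \<Rightarrow> 'y::topological_space set"
  assumes "\<And>n. closed_projection (R n)"
  shows "closed_projection (\<Union>n. R n)"
proof -
  obtain F :: "nat \<Rightarrow> ('y \<times> (nat \<Rightarrow> nat discrete)) set"
    where F: "\<And>n. closed (F n)" "\<And>n. fst ` F n = R n"
    using assms unfolding closed_projection_def by metis
  let ?shift = "\<lambda>p :: 'y \<times> (nat \<Rightarrow> nat discrete). (fst p, \<lambda>k. snd p (Suc k))"
  define G where "G = (\<Inter>n. (\<lambda>p :: 'y \<times> (nat \<Rightarrow> nat discrete). snd p 0) -` {x. of_discrete x \<noteq> n} \<union> ?shift -` F n)"
  have "closed G" unfolding G_def
    by (intro closed_INT ballI closed_Un closed_vimage F closed_discrete continuous_intros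
        continuous_on_product_coordinates continuous_on_coordinatewise_then_product
        continuous_on_product_then_coordinatewise)
  moreover have "fst ` G = (\<Union>n. R n)"
  proof (intro equalityI subsetI)
    fix y assume "y \<in> fst ` G"
    then obtain \<alpha> where "(y, \<alpha>) \<in> G" by auto
    then have "(y, \<lambda>k. \<alpha> (Suc k)) \<in> F (of_discrete (\<alpha> 0))" by (auto simp: G_def)
    then show "y \<in> (\<Union>n. R n)" using F(2) by force
  next
    fix y assume "y \<in> (\<Union>n. R n)"
    then obtain n where "y \<in> R n" by blast
    then obtain \<beta> where \<beta>: "(y, \<beta>) \<in> F n" using F(2) by force
    have "(y, case_nat (discrete n) \<beta>) \<in> G" using \<beta>
      by (auto simp: G_def discrete_inverse)
    then show "y \<in> fst ` G" by force
  qed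
  ultimately show ?thesis unfolding closed_projection_def by blast
qed

text \<open>One sequence encodes countably many, by a pairing function on the indices.\<close>
lemma closed_projection_INT:
  fixes R :: "nat \<Rightarrow> 'y::topological_space set"
  assumes "\<And>n. closed_projection (R n)"
  shows "closed_projection (\<Inter>n. R n)"
proof -
  obtain F :: "nat \<Rightarrow> ('y \<times> (nat \<Rightarrow> nat discrete)) set"
    where F: "\<And>n. closed (F n)" "\<And>n. fst ` F n = R n"
    using assms unfolding closed_projection_def by metis
  let ?part = "\<lambda>n (p :: 'y \<times> (nat \<Rightarrow> nat discrete)). (fst p, \<lambda>k. snd p (prod_encode (n, k)))"
  define G where "G = (\<Inter>n. ?part n -` F n)"
  have "closed G" unfolding G_def
    by (intro closed_INT ballI closed_vimage F continuous_intros
        continuous_on_coordinatewise_then_product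
        continuous_on_product_then_coordinatewise)
  moreover have "fst ` G = (\<Inter>n. R n)"
  proof (intro equalityI subsetI)
    fix y assume "y \<in> fst ` G"
    then obtain \<alpha> where "(y, \<alpha>) \<in> G" by auto
    then have "(y, \<lambda>k. \<alpha> (prod_encode (n, k))) \<in> F n" for n by (auto simp: G_def)
    then show "y \<in> (\<Inter>n. R n)" using F(2) by force
  next
    fix y assume "y \<in> (\<Inter>n. R n)"
    then have "\<forall>n. \<exists>\<beta>. (y, \<beta>) \<in> F n" using F(2) by force
    then obtain \<beta> where \<beta>: "\<And>n. (y, \<beta> n) \<in> F n" by metis
    have "(y, \<lambda>j. case prod_decode j of (n, k) \<Rightarrow> \<beta> n k) \<in> G" using \<beta> by (auto simp: G_def)
    then show "y \<in> fst ` G" by force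
  qed
  ultimately show ?thesis unfolding closed_projection_def by blast
qed

lemma closed_projection_open:
  fixes U :: "'y::metric_space set"
  assumes "open U" shows "closed_projection U"
proof (cases "U = UNIV")
  case False
  then have ne: "- U \<noteq> {}" by auto
  have pos: "x \<in> U \<longleftrightarrow> 0 < infdist x (- U)" for x
    using in_closed_iff_infdist_zero[of "- U" x] assms ne infdist_nonneg[of x "- U"]
    by (auto simp: closed_def less_le)
  have "x \<in> U \<longleftrightarrow> (\<exists>n. inverse (real (Suc n)) \<le> infdist x (- U))" for x
  proof
    assume "x \<in> U"
    then obtain n where "inverse (real (Suc n)) < infdist x (- U)"
      using reals_Archimedean pos by blast
    then show "\<exists>n. inverse (real (Suc n)) \<le> infdist x (- U)" by (auto intro: less_imp_le)
  next
    assume "\<exists>n. inverse (real (Suc n)) \<le> infdist x (- U)"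
    then obtain n where "inverse (real (Suc n)) \<le> infdist x (- U)" by blast
    moreover have "0 < inverse (real (Suc n))" by simp
    ultimately show "x \<in> U" unfolding pos by linarith
  qed
  then have "U = (\<Union>n. {x. inverse (real (Suc n)) \<le> infdist x (- U)})" by blast
  moreover have "closed_projection {x. inverse (real (Suc n)) \<le> infdist x (- U)}" for n
    by (intro closed_projection_closed closed_Collect_le continuous_intros)
  ultimately show ?thesis using closed_projection_UN by metis
qed (simp add: closed_projection_closed)

text \<open>The sets that are analytic together with their complements form a \<open>\<sigma>\<close>-algebra.\<close>
lemma closed_projection_borel:
  fixes R :: "'y::metric_space set"
  assumes "R \<in> sets borel"
  shows "closed_projection R"
proof -
  have "R \<in> sigma_sets UNIV {S. closed S}" using assms by (simp add: borel_eq_closed)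
  then have "closed_projection R \<and> closed_projection (- R)"
  proof induction
    case (Basic a)
    then show ?case by (auto intro: closed_projection_closed closed_projection_open)
  next
    case Empty
    then show ?case by (auto intro: closed_projection_closed)
  next
    case (Compl a)
    then show ?case by (simp add: Compl_eq_Diff_UNIV[symmetric])
  next
    case (Union a)
    then show ?case by (auto intro!: closed_projection_UN closed_projection_INT)
  qed
  then show ?thesis by simp
qed

lemma dense_sequence:
  obtains y :: "nat \<Rightarrow> 'a::{second_countable_topology, metric_space}"
  where "\<And>x e. 0 < e \<Longrightarrow> \<exists>n. dist x (y n) < e"
proof -
  obtain D :: "'a set" where D: "countable D" "\<And>X. open X \<Longrightarrow> X \<noteq> {} \<Longrightarrow> \<exists>d\<in>D. d \<in> X"
    using countable_dense_setE by metis
  have ne: "D \<noteq> {}" using D(2)[of UNIV] by auto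
  have "\<exists>n. dist x (from_nat_into D n) < e" if "0 < e" for x e
  proof -
    obtain z where "z \<in> D" "z \<in> ball x e" using D(2)[of "ball x e"] \<open>0 < e\<close>
      by (metis centre_in_ball empty_iff open_ball)
    then show ?thesis using from_nat_into_surj[OF D(1), of z] by auto
  qed
  then show ?thesis using that by blast
qed

text \<open>
  Choquet capacitability, in the case that is used below. The outer measure of the projection is
  continuous along increasing unions. One can therefore restrict \<open>F\<close> successively to finite unions of
  balls of radius \<open>1/(n+1)\<close> while the outer measure stays above \<open>c\<close>; the
  intersection of the restrictions is compact. A sequence with terms in the successive restrictions has
  a cluster point in the intersection, so that each neighbourhood of the projection of
  the intersection contains the projection of some restriction, and outer regularity gives the bound.
\<close>
lemma compact_subset_of_closed_projection:
  fixes M :: "'x::polish_space measure" and F :: "('x \<times> 'w::{complete_space, second_countable_topology}) set"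
  assumes M: "finite_measure M" "sets M = sets borel"
    and F: "closed F" "c < outer_measure_of M (fst ` F)"
  shows "\<exists>K\<subseteq>F. compact K \<and> c \<le> emeasure M (fst ` K)"
proof -
  interpret finite_measure M by fact
  have space: "space M = UNIV" using M(2) sets_eq_imp_space_eq[of M borel] by simp
  obtain y :: "nat \<Rightarrow> 'x \<times> 'w" where y: "\<And>x e. 0 < e \<Longrightarrow> \<exists>n. dist x (y n) < e"
    using dense_sequence by blast
  let ?B = "\<lambda>n k. \<Union>i\<le>k. cball (y i) (inverse (real (Suc n)))"
  have step: "\<exists>k. c < outer_measure_of M (fst ` (F \<inter> ?B n k))"
    if "c < outer_measure_of M (fst ` F)" for F :: "('x \<times> 'w) set" and n
  proof -
    have "x \<in> (\<Union>k. ?B n k)" for x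
      using y[of "inverse (real (Suc n))" x] by (auto simp: dist_commute intro: less_imp_le)
    then have "fst ` F = (\<Union>k. fst ` (F \<inter> ?B n k))" by blast
    moreover have "(SUP k. outer_measure_of M (fst ` (F \<inter> ?B n k)))
        = outer_measure_of M (\<Union>k. fst ` (F \<inter> ?B n k))"
    proof (rule SUP_outer_measure_of_incseq)
      show "incseq (\<lambda>k. fst ` (F \<inter> ?B n k))"
        by (intro monoI image_mono Int_mono order_refl UN_mono) auto
    qed (simp add: space)
    ultimately have "c < (SUP k. outer_measure_of M (fst ` (F \<inter> ?B n k)))"
      using that by simp
    then show ?thesis by (simp add: less_SUP_iff)
  qed
  \<comment> \<open>The successive restrictions of \<open>F\<close> to finite unions of small balls.\<close>
  have "\<exists>f. \<forall>n. (closed (f n) \<and> f n \<subseteq> F \<and> c < outer_measure_of M (fst ` f n)) \<and>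
      (f (Suc n) \<subseteq> f n \<and> (\<exists>k. f (Suc n) \<subseteq> ?B n k))"
  proof (rule dependent_nat_choice, goal_cases)
    case 1 show ?case using F by blast
  next
    case (2 f n)
    then obtain k where k: "c < outer_measure_of M (fst ` (f \<inter> ?B n k))" using step by blast
    have "closed (?B n k)" by (intro closed_UN) auto
    then show ?case using 2 k by (intro exI[of _ "f \<inter> ?B n k"]) auto
  qed
  then obtain f where f: "\<And>n. closed (f n)" "\<And>n. f n \<subseteq> F"
      "\<And>n. c < outer_measure_of M (fst ` f n)" "\<And>n. f (Suc n) \<subseteq> f n"
      and fB: "\<And>n. \<exists>k. f (Suc n) \<subseteq> ?B n k"
    by metis
  have dec: "f m \<subseteq> f n" if "n \<le> m" for n m
    using that f(4) by (rule lift_Suc_antimono_le[rotated])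
  define K where "K = (\<Inter>n. f n)"
  have cluster: "\<exists>l\<in>K. \<exists>r. strict_mono r \<and> (z \<circ> r) \<longlonglongrightarrow> l" if z: "\<And>n. z n \<in> f n" for z
  proof -
    have "\<exists>k. finite k \<and> closure (range z) \<subseteq> (\<Union>x\<in>k. ball x e)" if "0 < e" for e
    proof -
      obtain n where n: "inverse (real (Suc n)) < e" using reals_Archimedean[OF \<open>0 < e\<close>] by blast
      obtain k where k: "f (Suc n) \<subseteq> ?B n k" using fB by blast
      have "z i \<in> z ` {..n} \<union> ?B n k" for i
      proof (cases "i \<le> n")
        case False
        then have "z i \<in> f (Suc n)" using z[of i] dec[of "Suc n" i] by auto
        then show ?thesis using k by blast
      qed auto
      then have "range z \<subseteq> z ` {..n} \<union> ?B n k" by blast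
      moreover have "closed (z ` {..n} \<union> ?B n k)"
        by (intro closed_Un closed_UN finite_imp_closed) auto
      ultimately have "closure (range z) \<subseteq> z ` {..n} \<union> ?B n k" by (rule closure_minimal)
      moreover have "x \<in> (\<Union>x\<in>z ` {..n} \<union> y ` {..k}. ball x e)" if "x \<in> z ` {..n} \<union> ?B n k" for x
      proof (cases "x \<in> z ` {..n}")
        case True then show ?thesis using \<open>0 < e\<close> by (intro UN_I[of x]) auto
      next
        case False then show ?thesis using that n by fastforce
      qed
      ultimately have "closure (range z) \<subseteq> (\<Union>x\<in>z ` {..n} \<union> y ` {..k}. ball x e)" by blast
      then show ?thesis by (intro exI[of _ "z ` {..n} \<union> y ` {..k}"]) auto
    qed
    then have "compact (closure (range z))"
      by (simp add: compact_eq_totally_bounded complete_eq_closed)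
    then obtain l r where l: "strict_mono r" "(z \<circ> r) \<longlonglongrightarrow> l"
      by (rule compact_imp_seq_compact[THEN seq_compactE, of _ z])
        (use closure_subset[of "range z"] in auto)
    have "l \<in> f n" for n
    proof (rule Lim_in_closed_set[OF f(1) _ _ l(2)])
      show "\<forall>\<^sub>F i in sequentially. (z \<circ> r) i \<in> f n"
      proof (rule eventually_sequentiallyI[of n])
        fix i assume "n \<le> i"
        then have "n \<le> r i" using strict_mono_imp_increasing[OF l(1), of i] by linarith
        then show "(z \<circ> r) i \<in> f n" using z[of "r i"] dec by auto
      qed
    qed simp
    then show ?thesis using l by (auto simp: K_def)
  qed
  have K: "compact K"
    unfolding compact_eq_seq_compact_metric seq_compact_def
    using cluster by (metis INT_E K_def UNIV_I)
  have fK: "fst ` K \<in> sets borel"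
    by (intro borel_closed compact_imp_closed compact_continuous_image K continuous_intros)
  have "c \<le> emeasure M U" if U: "fst ` K \<subseteq> U" "open U" for U
  proof -
    have "\<exists>n. fst ` f n \<subseteq> U"
    proof (rule ccontr)
      assume "\<nexists>n. fst ` f n \<subseteq> U"
      then have "\<forall>n. \<exists>z\<in>f n. fst z \<notin> U" by blast
      then obtain z where z: "\<And>n. z n \<in> f n" "\<And>n. fst (z n) \<notin> U" by metis
      obtain l r where l: "l \<in> K" "strict_mono r" "(z \<circ> r) \<longlonglongrightarrow> l" using cluster z(1) by blast
      have "(\<lambda>i. fst ((z \<circ> r) i)) \<longlonglongrightarrow> fst l" by (intro tendsto_intros l)
      moreover have "fst l \<in> U" using l U by blast
      ultimately have "\<forall>\<^sub>F i in sequentially. fst ((z \<circ> r) i) \<in> U"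
        using U(2) by (auto dest: topological_tendstoD)
      then show False using z(2) by (auto simp: eventually_sequentially)
    qed
    then obtain n where "fst ` f n \<subseteq> U" by blast
    then have "outer_measure_of M (fst ` f n) \<le> outer_measure_of M U"
      by (rule outer_measure_of_mono)
    also have "\<dots> = emeasure M U" using U M by (intro outer_measure_of_eq) auto
    finally show ?thesis using f(3)[of n] by simp
  qed
  then have "c \<le> (INF U\<in>{U. fst ` K \<subseteq> U \<and> open U}. emeasure M U)"
    by (intro INF_greatest) auto
  also have "\<dots> = emeasure M (fst ` K)"
    by (rule outer_regular[symmetric]) (use M fK in auto)
  finally show ?thesis using K f(2) by (intro exI[of _ K]) (auto simp: K_def)
qed

text \<open>
  Building the code letter by letter, each time with the least letter that keeps \<open>P\<close> true, makes the
  choice of a point in a compact fibre measurable.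
\<close>
primrec least_code :: "(nat list \<Rightarrow> bool) \<Rightarrow> nat \<Rightarrow> nat list" where
  "least_code P 0 = []"
| "least_code P (Suc n) = least_code P n @ [LEAST i. P (least_code P n @ [i])]"

text \<open>
  Each fibre of \<open>K\<close> is cut down to a point by a sequence of balls of radius \<open>2\<^sup>-\<^sup>n\<close> whose centres are the
  earliest possible ones in a dense sequence. That a fibre meets a given finite intersection of balls
  is a closed condition on \<open>x\<close>, because it says that \<open>x\<close> lies in the projection of a compact set.
\<close>
lemma compact_selection:
  fixes K :: "('x::polish_space \<times> 'w::{complete_space, second_countable_topology}) set"
  assumes K: "compact K"
  shows "\<exists>f \<in> borel_measurable borel. \<forall>x\<in>fst ` K. (x, f x) \<in> K"
proof -
  obtain y :: "nat \<Rightarrow> 'w" where y: "\<And>x e. 0 < e \<Longrightarrow> \<exists>n. dist x (y n) < e"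
    using dense_sequence by blast
  define P where "P x l \<longleftrightarrow> (\<exists>w. (x, w) \<in> K \<and> (\<forall>k<length l. dist (y (l ! k)) w \<le> (1/2) ^ k))" for x l
  define L where "L x n = least_code (P x) n" for x n
  have L0: "L x 0 = []" and LS: "L x (Suc n) = L x n @ [LEAST i. P x (L x n @ [i])]" for x n
    unfolding L_def by (rule least_code.simps)+
  have [measurable]: "{x. P x l} \<in> sets borel" for l
  proof -
    have "{x. P x l} = fst ` (K \<inter> (UNIV \<times> (\<Inter>k\<in>{..<length l}. cball (y (l ! k)) ((1/2) ^ k))))"
    proof (intro equalityI subsetI)
      fix x assume "x \<in> {x. P x l}"
      then obtain w where "(x, w) \<in> K" "\<forall>k<length l. dist (y (l ! k)) w \<le> (1/2) ^ k"
        unfolding P_def by blast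
      then show "x \<in> fst ` (K \<inter> (UNIV \<times> (\<Inter>k\<in>{..<length l}. cball (y (l ! k)) ((1/2) ^ k))))"
        by (intro image_eqI[of _ _ "(x, w)"]) auto
    next
      fix x assume "x \<in> fst ` (K \<inter> (UNIV \<times> (\<Inter>k\<in>{..<length l}. cball (y (l ! k)) ((1/2) ^ k))))"
      then obtain w where "(x, w) \<in> K" "\<forall>k<length l. dist (y (l ! k)) w \<le> (1/2) ^ k"
        by auto
      then show "x \<in> {x. P x l}" unfolding P_def by blast
    qed
    also have "\<dots> \<in> sets borel"
      by (intro borel_closed compact_imp_closed compact_continuous_image compact_Int_closed K
          continuous_intros closed_Times closed_INT) auto
    finally show ?thesis .
  qed
  then have [measurable]: "Measurable.pred borel (\<lambda>x. P x l)" for l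
    by (simp add: pred_def)
  have [measurable]: "(\<lambda>x. L x n) \<in> measurable borel (count_space UNIV)" for n
  proof (induction n)
    case 0 then show ?case by (simp add: L0)
  next
    case (Suc n)
    show ?case unfolding LS
    proof (rule measurable_compose_countable[OF _ Suc, of "\<lambda>l x. l @ [LEAST i. P x (l @ [i])]"])
      fix l
      have "(\<lambda>x. LEAST i. P x (l @ [i])) \<in> measurable borel (count_space UNIV)"
        by (rule measurable_Least) measurable
      then show "(\<lambda>x. l @ [LEAST i. P x (l @ [i])]) \<in> measurable borel (count_space UNIV)"
        by (rule measurable_compose) simp
    qed
  qed
  have len: "length (L x n) = n" for x n by (induction n) (auto simp: L0 LS)
  have PL: "P x (L x n)" if "x \<in> fst ` K" for x n
  proof (induction n)
    case 0 then show ?case using that by (auto simp: P_def L0)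
  next
    case (Suc n)
    then obtain w where w: "(x, w) \<in> K" "\<forall>k<n. dist (y (L x n ! k)) w \<le> (1/2) ^ k"
      by (auto simp: P_def len)
    obtain i where "dist w (y i) < (1/2) ^ n" using y[of "(1/2) ^ n" w] by auto
    then have "P x (L x n @ [i])" using w
      by (auto simp: P_def len nth_append less_Suc_eq dist_commute intro!: exI[of _ w])
    then show ?case unfolding LS by (rule LeastI)
  qed
  define I where "I x n = L x (Suc n) ! n" for x n
  have LI: "L x n ! k = I x k" if "k < n" for x n k
    using that
  proof (induction n)
    case (Suc n)
    show ?case
    proof (cases "k = n")
      case False
      then have "k < n" using Suc by simp
      then have "L x (Suc n) ! k = L x n ! k" by (simp add: LS nth_append len)
      then show ?thesis using Suc \<open>k < n\<close> by simp
    qed (simp add: I_def)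
  qed simp
  have ex: "\<exists>w. (x, w) \<in> K \<and> (\<lambda>n. y (I x n)) \<longlonglongrightarrow> w" if x: "x \<in> fst ` K" for x
  proof -
    have "\<forall>n. \<exists>w. (x, w) \<in> K \<and> (\<forall>k<n. dist (y (I x k)) w \<le> (1/2) ^ k)"
      using PL[OF x] LI unfolding P_def len by metis
    then obtain w where w: "\<And>n. (x, w n) \<in> K" "\<And>n k. k < n \<Longrightarrow> dist (y (I x k)) (w n) \<le> (1/2) ^ k"
      by metis
    obtain l r where l: "l \<in> K" "strict_mono r" "((\<lambda>n. (x, w n)) \<circ> r) \<longlonglongrightarrow> l"
      using K w(1) unfolding compact_eq_seq_compact_metric seq_compact_def by (metis (no_types, lifting))
    from tendsto_fst[OF l(3)] have "x = fst l"
      by (simp add: comp_def LIMSEQ_const_iff)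
    then have lx: "(x, snd l) \<in> K" using l by simp
    from tendsto_snd[OF l(3)] have ws: "(\<lambda>n. w (r n)) \<longlonglongrightarrow> snd l" by (simp add: comp_def)
    have le: "dist (y (I x k)) (snd l) \<le> (1/2) ^ k" for k
    proof (rule Lim_bounded)
      show "(\<lambda>n. dist (y (I x k)) (w (r n))) \<longlonglongrightarrow> dist (y (I x k)) (snd l)"
        by (intro tendsto_intros ws)
      show "\<forall>n\<ge>Suc k. dist (y (I x k)) (w (r n)) \<le> (1/2) ^ k"
        using strict_mono_imp_increasing[OF l(2)] w(2) by (metis Suc_le_lessD order_trans)
    qed
    have "(\<lambda>k. dist (y (I x k)) (snd l)) \<longlonglongrightarrow> 0"
    proof (rule Lim_null_comparison)
      show "\<forall>\<^sub>F k in sequentially. norm (dist (y (I x k)) (snd l)) \<le> (1/2) ^ k"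
        using le by simp
      show "(\<lambda>k. (1/2::real) ^ k) \<longlonglongrightarrow> 0" by (intro LIMSEQ_power_zero) simp
    qed
    then have "(\<lambda>k. y (I x k)) \<longlonglongrightarrow> snd l" by (rule tendsto_dist_iff[THEN iffD2])
    then show ?thesis using lx by blast
  qed
  have fK: "fst ` K \<in> sets borel"
    by (intro borel_closed compact_imp_closed compact_continuous_image K continuous_intros)
  define f where "f x = (if x \<in> fst ` K then lim (\<lambda>n. y (I x n)) else y 0)" for x
  have f: "(\<lambda>n. y (I x n)) \<longlonglongrightarrow> f x" "(x, f x) \<in> K" if "x \<in> fst ` K" for x
  proof -
    obtain w where "(x, w) \<in> K" "(\<lambda>n. y (I x n)) \<longlonglongrightarrow> w" using ex[OF \<open>x \<in> fst ` K\<close>] by blast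
    moreover from this have "f x = w" using \<open>x \<in> fst ` K\<close> by (simp add: f_def limI)
    ultimately show "(\<lambda>n. y (I x n)) \<longlonglongrightarrow> f x" "(x, f x) \<in> K" by simp_all
  qed
  have I[measurable]: "(\<lambda>x. I x n) \<in> measurable borel (count_space UNIV)" for n
    unfolding I_def by measurable
  have "f \<in> borel_measurable borel"
  proof (rule borel_measurable_LIMSEQ_metric)
    fix x show "(\<lambda>n. if x \<in> fst ` K then y (I x n) else y 0) \<longlonglongrightarrow> f x"
    proof (cases "x \<in> fst ` K")
      case True then show ?thesis using f(1) by simp
    next
      case False then show ?thesis unfolding f_def by simp
    qed
  next
    fix n
    have "(\<lambda>x. y (I x n)) \<in> borel_measurable borel"
      using measurable_compose[OF I, of y borel] by simp
    then show "(\<lambda>x. if x \<in> fst ` K then y (I x n) else y 0) \<in> borel_measurable borel"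
      using fK by (intro measurable_If_set) auto
  qed
  then show ?thesis using f(2) by blast
qed

text \<open>
  Jankov-von Neumann uniformization up to a null set. Both \<open>Z\<close> and the auxiliary Baire space are put into
  the second factor, and compact sets whose projections have measure at least \<open>1 - 1/(n+1)\<close> are
  uniformized one after the other.
\<close>
theorem measurable_selection:
  fixes M :: "'x::polish_space measure" and R :: "('x \<times> 'z::polish_space) set"
  assumes M: "prob_space M" "sets M = sets borel"
    and R: "R \<in> sets borel" "\<And>x. \<exists>z. (x, z) \<in> R"
  shows "\<exists>f \<in> borel_measurable M. AE x in M. (x, f x) \<in> R"
proof -
  interpret prob_space M by fact
  have space: "space M = UNIV" using M(2) sets_eq_imp_space_eq[of M borel] by simp
  obtain F :: "(('x \<times> 'z) \<times> (nat \<Rightarrow> nat discrete)) set" where F: "closed F" "fst ` F = R"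
    using closed_projection_borel[OF R(1)] unfolding closed_projection_def by blast
  define F' where "F' = (\<lambda>(x, z, \<alpha>). ((x, z), \<alpha>)) -` F"
  have "closed F'" unfolding F'_def case_prod_beta
    by (intro closed_vimage F continuous_intros)
  have "x \<in> fst ` F'" for x
  proof -
    obtain z where "(x, z) \<in> R" using R(2) by blast
    then obtain \<alpha> where "((x, z), \<alpha>) \<in> F" using F(2) by force
    then have "(x, z, \<alpha>) \<in> F'" by (simp add: F'_def)
    then show ?thesis by force
  qed
  then have full: "fst ` F' = UNIV" by blast
  have "outer_measure_of M (fst ` F') = emeasure M (space M)"
    unfolding full space[symmetric] by (rule outer_measure_of_eq) simp
  also have "\<dots> = 1" by (rule emeasure_space_1)
  finally have "ennreal (1 - inverse (real (Suc n))) < outer_measure_of M (fst ` F')" for n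
    by (simp add: ennreal_less_one_iff)
  then have "\<forall>n. \<exists>K\<subseteq>F'. compact K \<and> ennreal (1 - inverse (real (Suc n))) \<le> emeasure M (fst ` K)"
    using compact_subset_of_closed_projection[OF finite_measure_axioms M(2) \<open>closed F'\<close>] by blast
  then obtain K where K: "\<And>n. K n \<subseteq> F'" "\<And>n. compact (K n)"
      "\<And>n. ennreal (1 - inverse (real (Suc n))) \<le> emeasure M (fst ` K n)"
    by metis
  obtain f where f: "\<And>n. f n \<in> borel_measurable borel" "\<And>n x. x \<in> fst ` K n \<Longrightarrow> (x, f n x) \<in> K n"
    using compact_selection[OF K(2)] by metis
  have fK[measurable]: "fst ` K n \<in> sets M" for n unfolding M(2)
    by (intro borel_closed compact_imp_closed compact_continuous_image K continuous_intros)
  have null: "emeasure M (space M - (\<Union>n. fst ` K n)) = 0"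
  proof -
    have "prob (space M - (\<Union>n. fst ` K n)) \<le> inverse (real (Suc n))" for n
    proof -
      have "1 - inverse (real (Suc n)) \<le> prob (fst ` K n)"
        using K(3)[of n] by (simp add: emeasure_eq_measure)
      also have "\<dots> \<le> prob (\<Union>n. fst ` K n)" by (rule finite_measure_mono) auto
      also have "\<dots> = 1 - prob (space M - (\<Union>n. fst ` K n))"
        by (subst prob_compl) auto
      finally show ?thesis by simp
    qed
    then have "prob (space M - (\<Union>n. fst ` K n)) \<le> 0"
      using reals_Archimedean by (meson leD leI order_le_less_trans)
    then show ?thesis by (simp add: emeasure_eq_measure measure_le_0_iff)
  qed
  define g where "g x = fst (f (LEAST n. x \<in> fst ` K n) x)" for x
  have "(\<lambda>x. f (LEAST n. x \<in> fst ` K n) x) \<in> borel_measurable M"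
  proof (rule measurable_compose_countable[of f])
    show "f n \<in> borel_measurable M" for n using f(1) M(2) by (simp cong: measurable_cong_sets)
  qed measurable
  then have "g \<in> borel_measurable M" unfolding g_def
    by (rule measurable_compose) (simp add: borel_measurable_continuous_onI continuous_on_fst)
  moreover have "AE x in M. (x, g x) \<in> R"
  proof (rule AE_I[OF _ null])
    have "(x, g x) \<in> R" if "x \<in> fst ` K n" for x n
    proof -
      let ?n = "LEAST n. x \<in> fst ` K n"
      have "x \<in> fst ` K ?n" using that by (rule LeastI)
      then have "(x, f ?n x) \<in> F'" using f(2) K(1) by blast
      then show ?thesis using F(2) by (force simp: F'_def g_def split: prod.splits)
    qed
    then show "{x \<in> space M. (x, g x) \<notin> R} \<subseteq> space M - (\<Union>n. fst ` K n)" by auto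
  qed measurable
  ultimately show ?thesis by blast
qed

section \<open>The Baire property and Pettis' lemma\<close>

definition dense_open :: "'a::topological_space set \<Rightarrow> bool" where
  "dense_open O' \<longleftrightarrow> open O' \<and> (\<forall>W. open W \<and> W \<noteq> {} \<longrightarrow> W \<inter> O' \<noteq> {})"

lemma baire_category:
  fixes D :: "nat \<Rightarrow> 'a::complete_space set"
  assumes D: "\<And>n. dense_open (D n)" and W: "open W" "W \<noteq> {}"
  obtains x where "x \<in> W" "\<And>n. x \<in> D n"
proof -
  have "Met_TC.mtopology closure_of \<Inter>(range D) = (UNIV :: 'a set)"
  proof (rule Met_TC.metric_Baire_category)
    show "Met_TC.mcomplete TYPE('a)"
      by (simp add: complete_UNIV)
    fix T assume "T \<in> range D"
    then obtain n where T: "T = D n" by blast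
    have "open (- closure (D n))" "- closure (D n) \<inter> D n = {}"
      using closure_subset[of "D n"] by auto
    then have "- closure (D n) = {}" using D[of n] unfolding dense_open_def by blast
    then have "closure (D n) = UNIV" by blast
    then show "openin Met_TC.mtopology T \<and> Met_TC.mtopology closure_of T = UNIV"
      using D[of n] unfolding T dense_open_def by simp
  qed simp
  then have "closure (\<Inter>n. D n) = UNIV" by simp
  then have "W \<inter> (\<Inter>n. D n) \<noteq> {}"
    using W by (metis Int_UNIV_right open_Int_closure_eq_empty)
  then show ?thesis using that by blast
qed

text \<open>
  A set has the Baire property if it agrees with an open set on a comeagre set; the comeagre set is
  given by a sequence of dense open sets.
\<close>
definition baire_property :: "'a::topological_space set \<Rightarrow> bool" where
  "baire_property E \<longleftrightarrow> (\<exists>U D. open U \<and> (\<forall>n::nat. dense_open (D n)) \<and>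
     (\<forall>x. (\<forall>n. x \<in> D n) \<longrightarrow> (x \<in> E \<longleftrightarrow> x \<in> U)))"

lemma baire_property_borel:
  assumes "E \<in> sets borel"
  shows "baire_property E"
proof -
  have "E \<in> sigma_sets UNIV {S. open S}" using assms by (simp add: borel_def)
  then show ?thesis
  proof induction
    case (Basic U)
    then show ?case unfolding baire_property_def
      by (intro exI[of _ U] exI[of _ "\<lambda>_. UNIV"]) (auto simp: dense_open_def)
  next
    case Empty
    then show ?case unfolding baire_property_def
      by (intro exI[of _ "{}"] exI[of _ "\<lambda>_. UNIV"]) (auto simp: dense_open_def)
  next
    case (Compl E)
    then obtain U D where U: "open U" "\<And>n::nat. dense_open (D n)"
        "\<And>x. (\<And>n. x \<in> D n) \<Longrightarrow> x \<in> E \<longleftrightarrow> x \<in> U"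
      unfolding baire_property_def by metis
    let ?D = "case_nat (U \<union> - closure U) D"
    have "W \<inter> (U \<union> - closure U) \<noteq> {}" if "open W" "W \<noteq> {}" for W
      using that open_Int_closure_eq_empty[of W U] by blast
    then have "dense_open (U \<union> - closure U)"
      using U(1) by (auto simp: dense_open_def)
    then have "dense_open (?D n)" for n using U(2) by (cases n) auto
    moreover have "x \<in> UNIV - E \<longleftrightarrow> x \<in> - closure U" if "\<And>n. x \<in> ?D n" for x
    proof -
      have "x \<in> D n" for n using that[of "Suc n"] by simp
      moreover have "x \<in> U \<union> - closure U" using that[of 0] by simp
      ultimately show ?thesis using U(3) closure_subset[of U] by blast
    qed
    ultimately show ?case unfolding baire_property_def
      by (intro exI[of _ "- closure U"] exI[of _ ?D]) auto
  next
    case (Union E)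
    then have "\<forall>i. \<exists>U D. open U \<and> (\<forall>n::nat. dense_open (D n)) \<and>
        (\<forall>x. (\<forall>n. x \<in> D n) \<longrightarrow> (x \<in> E i \<longleftrightarrow> x \<in> U))"
      unfolding baire_property_def by blast
    then obtain U D where U: "\<And>i. open (U i)" "\<And>i n::nat. dense_open (D i n)"
        "\<And>i x. (\<And>n. x \<in> D i n) \<Longrightarrow> x \<in> E i \<longleftrightarrow> x \<in> U i"
      by metis
    have "x \<in> (\<Union>i. E i) \<longleftrightarrow> x \<in> (\<Union>i. U i)"
      if x: "\<And>j. x \<in> (case prod_decode j of (i, n) \<Rightarrow> D i n)" for x
    proof -
      have "x \<in> D i n" for i n using x[of "prod_encode (i, n)"] by simp
      then have "x \<in> E i \<longleftrightarrow> x \<in> U i" for i by (rule U(3))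
      then show ?thesis by simp
    qed
    moreover have "open (\<Union>i. U i)" using U(1) by blast
    moreover have "dense_open (case prod_decode j of (i, n) \<Rightarrow> D i n)" for j
      by (simp add: U(2) split: prod.split)
    ultimately show ?case unfolding baire_property_def
      by (intro exI[of _ "\<Union>i. U i"] exI[of _ "\<lambda>j. case prod_decode j of (i, n) \<Rightarrow> D i n"] conjI allI impI)
        simp_all
  qed
qed

lemma open_left_translate:
  fixes U :: "'g::topological_group_add set"
  assumes "open U" shows "open {x. g + x \<in> U}"
  using open_vimage[OF assms, of "\<lambda>x. g + x"] by (simp add: vimage_def continuous_intros)

lemma open_right_translate:
  fixes U :: "'g::topological_group_add set"
  assumes "open U" shows "open {x. x + g \<in> U}"
  using open_vimage[OF assms, of "\<lambda>x. x + g"] by (simp add: vimage_def continuous_intros)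

lemma dense_open_left_translate:
  fixes U :: "'g::topological_group_add set"
  assumes "dense_open U" shows "dense_open {x. g + x \<in> U}"
  unfolding dense_open_def
proof (intro conjI allI impI)
  show "open {x. g + x \<in> U}" using assms by (simp add: dense_open_def open_left_translate)
  fix W :: "'g set" assume W: "open W \<and> W \<noteq> {}"
  then obtain w where w: "w \<in> W" by blast
  have "open {x. - g + x \<in> W}" using W by (simp add: open_left_translate)
  moreover have "g + w \<in> {x. - g + x \<in> W}" using w by (simp add: add.assoc[symmetric])
  ultimately obtain x where "- g + x \<in> W" "x \<in> U" using assms unfolding dense_open_def by blast
  then have "- g + x \<in> W \<inter> {x. g + x \<in> U}" by (simp add: add.assoc[symmetric])
  then show "W \<inter> {x. g + x \<in> U} \<noteq> {}" by blast
qed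

text \<open>
  Countably many translates of \<open>E\<close> cover the group, hence \<open>E\<close> is not meagre, and it agrees with a
  nonempty open set \<open>U\<close> up to a meagre set. If \<open>g\<close> is so small that \<open>U\<close> meets \<open>{x. x + g \<in> U}\<close>, a generic \<open>x\<close>
  in their intersection has both \<open>x\<close> and \<open>x + g\<close> in \<open>E\<close>.
\<close>
lemma pettis:
  fixes E :: "'g::{complete_space, topological_group_add} set"
  assumes E: "E \<in> sets borel" and cover: "\<And>x. \<exists>n::nat. - c n + x \<in> E"
  obtains V where "open V" "0 \<in> V" "\<And>g. g \<in> V \<Longrightarrow> \<exists>a\<in>E. \<exists>b\<in>E. g = - a + b"
proof -
  obtain U D where U: "open U" "\<And>n::nat. dense_open (D n)"
      "\<And>x. (\<And>n. x \<in> D n) \<Longrightarrow> x \<in> E \<longleftrightarrow> x \<in> U"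
    using baire_property_borel[OF E] unfolding baire_property_def by metis
  have "U \<noteq> {}"
  proof
    assume "U = {}"
    let ?D = "\<lambda>j. case prod_decode j of (m, n) \<Rightarrow> {x. - c m + x \<in> D n}"
    have "dense_open (?D j)" for j
      by (auto split: prod.splits intro!: dense_open_left_translate U)
    then obtain x where x: "\<And>j. x \<in> ?D j"
      using baire_category[of ?D UNIV] by blast
    obtain m where "- c m + x \<in> E" using cover by blast
    moreover have "- c m + x \<in> D n" for n using x[of "prod_encode (m, n)"] by simp
    ultimately show False using U(3) \<open>U = {}\<close> by blast
  qed
  then obtain u where u: "u \<in> U" by blast
  show ?thesis
  proof (rule that[of "{g. u + g \<in> U}"])
    show "open {g. u + g \<in> U}" by (rule open_left_translate) fact
    fix g assume "g \<in> {g. u + g \<in> U}"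
    then have "U \<inter> {x. x + g \<in> U} \<noteq> {}" using u by blast
    moreover have "open (U \<inter> {x. x + g \<in> U})" using U(1) by (simp add: open_Int open_right_translate)
    moreover have "dense_open {x. x + g \<in> D n}" for n
      unfolding dense_open_def
    proof (intro conjI allI impI)
      show "open {x. x + g \<in> D n}" using U(2) by (simp add: dense_open_def open_right_translate)
      fix W :: "'g set" assume W: "open W \<and> W \<noteq> {}"
      then obtain w where w: "w \<in> W" by blast
      have "open {x. x + - g \<in> W}" using W by (intro open_right_translate) simp
      moreover have "w + g \<in> {x. x + - g \<in> W}" using w by (simp add: add.assoc)
      ultimately obtain x where "x + - g \<in> W" "x \<in> D n" using U(2)[of n] unfolding dense_open_def by blast
      then have "x + - g \<in> W \<inter> {x. x + g \<in> D n}" by (simp add: add.assoc)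
      then show "W \<inter> {x. x + g \<in> D n} \<noteq> {}" by blast
    qed
    then have "dense_open (case_sum D (\<lambda>n. {x. x + g \<in> D n}) (sum_decode j))" for j
      using U(2) by (auto split: sum.splits)
    ultimately obtain x where x: "x \<in> U" "x + g \<in> U"
      and xD: "\<And>j. x \<in> case_sum D (\<lambda>n. {x. x + g \<in> D n}) (sum_decode j)"
      using baire_category[of "\<lambda>j. case_sum D (\<lambda>n. {x. x + g \<in> D n}) (sum_decode j)"] by blast
    have "x \<in> D n" "x + g \<in> D n" for n
      using xD[of "sum_encode (Inl n)"] xD[of "sum_encode (Inr n)"] by auto
    then have "x \<in> E" "x + g \<in> E" using U(3) x by blast+
    then show "\<exists>a\<in>E. \<exists>b\<in>E. g = - a + b"
      by (intro bexI[of _ x] bexI[of _ "x + g"]) (auto simp: add.assoc[symmetric])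
  qed (use u in auto)
qed

section \<open>Continuity of the action on the measure algebra\<close>

locale mp_action = prob_space M for M :: "'x::polish_space measure" +
  fixes act :: "'g::{polish_space, topological_group_add} \<Rightarrow> 'x \<Rightarrow> 'x"
  assumes sets_M: "sets M = sets borel" and action: "mp_borel_action M act"
begin

lemma space_M [simp]: "space M = UNIV"
  using sets_M sets_eq_imp_space_eq[of M borel] by simp

lemma act_zero [simp]: "act 0 x = x"
  and act_add: "act (g + h) x = act g (act h x)"
  and measurable_act_pair: "(\<lambda>(g, x). act g x) \<in> measurable (borel \<Otimes>\<^sub>M M) M"
  and emeasure_act_image: "A \<in> sets M \<Longrightarrow> emeasure M (act g ` A) = emeasure M A"
  using action by (auto simp: mp_borel_action_def)

lemma act_minus [simp]: "act (- g) (act g x) = x" "act g (act (- g) x) = x"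
  by (simp_all flip: act_add)

lemma inj_act: "inj_on (act g) A"
  by (metis act_minus(1) inj_onI)

lemma act_image_vimage: "act g ` A = act (- g) -` A"
  by (auto simp: image_iff) (metis act_minus(2))

lemma act_image_add: "act (g + h) ` A = act g ` act h ` A"
  by (auto simp: act_add image_image)

lemma act_image_zero [simp]: "act 0 ` A = A"
  by simp

lemma measurable_act [measurable]: "act g \<in> measurable M M"
  using measurable_compose_Pair1[OF _ measurable_act_pair, of g] by simp

lemma sets_act_image [measurable, simp]: "A \<in> sets M \<Longrightarrow> act g ` A \<in> sets M"
  unfolding act_image_vimage using measurable_sets[OF measurable_act, of A "- g"] by simp

lemma measure_act_image [simp]: "A \<in> sets M \<Longrightarrow> measure M (act g ` A) = measure M A"
  using emeasure_act_image[of A g] by (simp add: measure_def)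

text \<open>The metric of the measure algebra.\<close>
definition dev :: "'x set \<Rightarrow> 'x set \<Rightarrow> real" where
  "dev A B = measure M (sym_diff A B)"

lemma dev_commute: "dev A B = dev B A"
  by (simp add: dev_def Un_commute)

lemma dev_triangle:
  assumes "A \<in> sets M" "B \<in> sets M" "C \<in> sets M"
  shows "dev A C \<le> dev A B + dev B C"
proof -
  have "dev A C \<le> measure M (sym_diff A B \<union> sym_diff B C)"
    unfolding dev_def using assms by (intro finite_measure_mono) auto
  also have "\<dots> \<le> dev A B + dev B C"
    unfolding dev_def using assms by (intro measure_Un_le) auto
  finally show ?thesis .
qed

lemma dev_act:
  assumes "A \<in> sets M" "B \<in> sets M"
  shows "dev (act g ` A) (act g ` B) = dev A B"
proof -
  have "sym_diff (act g ` A) (act g ` B) = act g ` sym_diff A B"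
    by (auto dest: inj_onD[OF inj_act[of g UNIV]])
  then show ?thesis using assms by (simp add: dev_def)
qed

lemma measure_le_dev:
  assumes "A \<in> sets M" "B \<in> sets M" "C \<in> sets M"
  shows "measure M (A \<inter> C) \<le> measure M (B \<inter> C) + dev A B"
proof -
  have "measure M (A \<inter> C) \<le> measure M ((B \<inter> C) \<union> sym_diff A B)"
    using assms by (intro finite_measure_mono) auto
  also have "\<dots> \<le> measure M (B \<inter> C) + dev A B"
    unfolding dev_def using assms by (intro measure_Un_le) auto
  finally show ?thesis .
qed

text \<open>By outer regularity, the finite unions of basic open sets are dense in the measure algebra.\<close>
lemma separable_measure_algebra:
  obtains \<U> where "countable \<U>" "\<U> \<subseteq> sets M"
    "\<And>A e. A \<in> sets M \<Longrightarrow> 0 < e \<Longrightarrow> \<exists>U\<in>\<U>. dev A U < e"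
proof -
  obtain \<B> :: "'x set set" where \<B>: "countable \<B>" "topological_basis \<B>"
    using ex_countable_basis by blast
  define \<U> where "\<U> = Union ` {F. finite F \<and> F \<subseteq> \<B>}"
  have "countable \<U>" unfolding \<U>_def
    by (intro countable_image countable_Collect_finite_subset \<B>)
  moreover have op: "open U" if "U \<in> \<U>" for U
    using that topological_basis_open[OF \<B>(2)] by (auto simp: \<U>_def)
  then have sub: "\<U> \<subseteq> sets M" by (auto simp: sets_M)
  moreover have "\<exists>U\<in>\<U>. dev A U < e" if A: "A \<in> sets M" and "0 < e" for A e
  proof -
    have "emeasure M A = (INF U\<in>{U. A \<subseteq> U \<and> open U}. emeasure M U)"
      using A by (intro outer_regular) (auto simp: sets_M)
    moreover have "emeasure M A < ennreal (measure M A + e / 2)"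
      using \<open>0 < e\<close> by (simp add: emeasure_eq_measure ennreal_lessI)
    ultimately obtain V where V: "A \<subseteq> V" "open V" "emeasure M V < ennreal (measure M A + e / 2)"
      by (auto simp: INF_less_iff)
    have [measurable]: "V \<in> sets M" using V(2) by (simp add: sets_M)
    have VA: "measure M (V - A) < e / 2"
    proof -
      have "measure M V < measure M A + e / 2"
        using V(3) by (simp add: emeasure_eq_measure ennreal_less_iff del: ennreal_plus)
      then show ?thesis using V(1) A by (simp add: finite_measure_Diff)
    qed
    obtain \<F> where \<F>: "\<F> \<subseteq> \<B>" "\<Union>\<F> = V" using \<B>(2) V(2) by (auto simp: topological_basis_def)
    have "\<exists>U\<in>\<U>. U \<subseteq> V \<and> measure M (V - U) < e / 2"
    proof (cases "\<F> = {}")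
      case True
      then show ?thesis using \<F> \<open>0 < e\<close> by (intro bexI[of _ "{}"]) (auto simp: \<U>_def)
    next
      case False
      let ?U = "\<lambda>n. \<Union>i\<le>n. from_nat_into \<F> i"
      have cF: "countable \<F>" using \<F>(1) \<B>(1) by (rule countable_subset)
      have in\<F>: "from_nat_into \<F> i \<in> \<F>" for i using False by (rule from_nat_into)
      have U: "?U n \<in> \<U>" for n unfolding \<U>_def
        by (rule image_eqI[of _ _ "from_nat_into \<F> ` {..n}"]) (use in\<F> \<F>(1) in auto)
      have "V = (\<Union>n. ?U n)"
      proof (intro equalityI subsetI)
        fix x assume "x \<in> V"
        then obtain i where "x \<in> from_nat_into \<F> i"
          using \<F>(2) range_from_nat_into[OF False cF] by blast
        then show "x \<in> (\<Union>n. ?U n)" by blast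
      qed (use \<F>(2) in\<F> in blast)
      moreover have "(\<lambda>n. measure M (?U n)) \<longlonglongrightarrow> measure M (\<Union>n. ?U n)"
      proof (rule finite_Lim_measure_incseq)
        show "range ?U \<subseteq> sets M" using U sub by blast
        show "incseq ?U" by (intro monoI UN_mono) auto
      qed
      ultimately have "(\<lambda>n. measure M (?U n)) \<longlonglongrightarrow> measure M V" by simp
      then have "\<forall>\<^sub>F n in sequentially. measure M V - e / 2 < measure M (?U n)"
        by (rule order_tendstoD) (use \<open>0 < e\<close> in simp)
      then obtain n where n: "measure M V - e / 2 < measure M (?U n)"
        by (auto simp: eventually_sequentially)
      have "?U n \<subseteq> V" using \<F>(2) in\<F> by blast
      moreover have "measure M (V - ?U n) = measure M V - measure M (?U n)"
        by (rule finite_measure_Diff) (use \<open>?U n \<subseteq> V\<close> U sub in auto)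
      ultimately show ?thesis using U n by (intro bexI[of _ "?U n"]) auto
    qed
    then obtain U where U: "U \<in> \<U>" "U \<subseteq> V" "measure M (V - U) < e / 2" by blast
    have [measurable]: "U \<in> sets M" using U sub by blast
    have "dev A U \<le> dev A V + dev V U" using A by (intro dev_triangle) auto
    also have "dev A V = measure M (V - A)" unfolding dev_def by (rule arg_cong[of _ _ "measure M"]) (use V in blast)
    also have "dev V U = measure M (V - U)" unfolding dev_def by (rule arg_cong[of _ _ "measure M"]) (use U in blast)
    finally show ?thesis using VA U by (intro bexI[of _ U]) auto
  qed
  ultimately show ?thesis by (rule that)
qed

lemma measurable_dev_act [measurable]:
  assumes [measurable]: "B \<in> sets M"
  shows "(\<lambda>g. dev (act g ` B) B) \<in> borel_measurable borel"
proof -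
  have [measurable]: "(\<lambda>p :: 'g \<times> 'x. act (- fst p) (snd p)) \<in> measurable (borel \<Otimes>\<^sub>M M) M"
  proof -
    have [measurable]: "(uminus :: 'g \<Rightarrow> 'g) \<in> borel_measurable borel"
      by (intro borel_measurable_continuous_onI continuous_intros)
    have "(\<lambda>p :: 'g \<times> 'x. (- fst p, snd p)) \<in> measurable (borel \<Otimes>\<^sub>M M) (borel \<Otimes>\<^sub>M M)"
      by measurable
    from measurable_compose[OF this measurable_act_pair] show ?thesis by simp
  qed
  let ?Q = "{p \<in> space (borel \<Otimes>\<^sub>M M :: ('g \<times> 'x) measure). (act (- fst p) (snd p) \<in> B) \<noteq> (snd p \<in> B)}"
  have "?Q \<in> sets (borel \<Otimes>\<^sub>M M)" by measurable
  then have "(\<lambda>g. emeasure M (Pair g -` ?Q)) \<in> borel_measurable borel"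
    by (rule measurable_emeasure_Pair)
  moreover have eq: "Pair g -` ?Q = sym_diff (act g ` B) B" for g
    unfolding act_image_vimage by (auto simp: space_pair_measure)
  ultimately have "(\<lambda>g. emeasure M (sym_diff (act g ` B) B)) \<in> borel_measurable borel"
    unfolding eq by blast
  then show ?thesis unfolding dev_def measure_def by measurable
qed

text \<open>
  Automatic continuity. The set \<open>E\<close> of the group elements that move \<open>B\<close> by less than \<open>e/2\<close> is Borel by
  Fubini's theorem. Since the orbit of \<open>B\<close> in the measure algebra is separable, countably
  many translates of \<open>E\<close> cover the group. Pettis' lemma applies, and the elements \<open>- a + b\<close> with \<open>a, b \<in> E\<close> move \<open>B\<close> by
  less than \<open>e\<close>.
\<close>
lemma act_continuous_at_zero:
  assumes B: "B \<in> sets M" and "0 < e"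
  obtains V where "open V" "0 \<in> V" "\<And>g. g \<in> V \<Longrightarrow> dev (act g ` B) B < e"
proof -
  obtain \<U> where \<U>: "countable \<U>" "\<U> \<subseteq> sets M"
    "\<And>A e. A \<in> sets M \<Longrightarrow> 0 < e \<Longrightarrow> \<exists>U\<in>\<U>. dev A U < e"
    using separable_measure_algebra by metis
  have ne: "\<U> \<noteq> {}" using \<U>(3)[OF B \<open>0 < e\<close>] by blast
  \<comment> \<open>For each member of the dense family, a translate of \<open>B\<close> close to it, if there is one.\<close>
  define c where "c n = (SOME g. dev (act g ` B) (from_nat_into \<U> n) < e / 4)" for n
  let ?E = "{g. dev (act g ` B) B < e / 2}"
  have "?E \<in> sets borel"
    using measurable_sets[OF measurable_dev_act[OF B], of "{..<e/2}"] by (simp add: vimage_def)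
  moreover have "\<exists>n. - c n + g \<in> ?E" for g
  proof -
    obtain U where U: "U \<in> \<U>" "dev (act g ` B) U < e / 4" using \<U>(3)[of "act g ` B" "e / 4"] B \<open>0 < e\<close> by auto
    obtain n where n: "from_nat_into \<U> n = U" using from_nat_into_surj[OF \<U>(1) U(1)] by blast
    have c: "dev (act (c n) ` B) U < e / 4"
      unfolding c_def n using U(2) by (rule someI)
    have "dev (act (- c n + g) ` B) B = dev (act (- c n) ` act g ` B) (act (- c n) ` act (c n) ` B)"
      by (simp flip: act_image_add)
    also have "\<dots> = dev (act g ` B) (act (c n) ` B)" using B by (intro dev_act) auto
    also have "\<dots> \<le> dev (act g ` B) U + dev U (act (c n) ` B)"
      using B U \<U> by (intro dev_triangle) auto
    also have "\<dots> < e / 2" using U(2) c by (simp add: dev_commute)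
    finally show ?thesis by auto
  qed
  ultimately obtain V where V: "open V" "0 \<in> V" "\<And>g. g \<in> V \<Longrightarrow> \<exists>a\<in>?E. \<exists>b\<in>?E. g = - a + b"
    by (rule pettis) blast
  have "dev (act g ` B) B < e" if g: "g \<in> V" for g
  proof -
    obtain a b where ab: "dev (act a ` B) B < e / 2" "dev (act b ` B) B < e / 2" "g = - a + b"
      using V(3)[OF g] by blast
    have "dev (act g ` B) B = dev (act (- a) ` act b ` B) (act (- a) ` act a ` B)"
      unfolding ab(3) by (simp flip: act_image_add)
    also have "\<dots> = dev (act b ` B) (act a ` B)" using B by (intro dev_act) auto
    also have "\<dots> \<le> dev (act b ` B) B + dev B (act a ` B)"
      using B by (intro dev_triangle) auto
    also have "\<dots> < e" using ab by (simp add: dev_commute)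
    finally show ?thesis .
  qed
  then show ?thesis using V that by blast
qed

text \<open>
  This is how a dense subgroup comes in: if some element of an open set \<open>V\<close> moves \<open>A\<close> onto a
  non-null part of \<open>B\<close>, then so does an element of the dense subgroup in \<open>V\<close>.
\<close>
lemma open_measure_pos:
  assumes A: "A \<in> sets M" and B: "B \<in> sets M"
  shows "open {g. 0 < measure M (act g ` A \<inter> B)}"
proof (subst open_subopen, clarify)
  fix g assume "0 < measure M (act g ` A \<inter> B)"
  then obtain V where V: "open V" "0 \<in> V" "\<And>k. k \<in> V \<Longrightarrow> dev (act k ` A) A < measure M (act g ` A \<inter> B)"
    using act_continuous_at_zero[OF A] by blast
  have "0 < measure M (act h ` A \<inter> B)" if "- g + h \<in> V" for h
  proof -
    have h: "h = g + (- g + h)" by (simp add: add.assoc[symmetric])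
    have "measure M (act g ` A \<inter> B) \<le> measure M (act h ` A \<inter> B) + dev (act g ` A) (act h ` A)"
      using A B by (intro measure_le_dev) auto
    also have "dev (act g ` A) (act h ` A) = dev (act g ` A) (act g ` act (- g + h) ` A)"
      by (subst h) (simp only: act_image_add)
    also have "\<dots> = dev A (act (- g + h) ` A)" using A by (intro dev_act) auto
    also have "\<dots> < measure M (act g ` A \<inter> B)" using V(3)[OF that] by (simp add: dev_commute)
    finally show ?thesis by simp
  qed
  then show "\<exists>T. open T \<and> g \<in> T \<and> T \<subseteq> {g. 0 < measure M (act g ` A \<inter> B)}"
    using V by (intro exI[of _ "{h. - g + h \<in> V}"]) (auto intro: open_left_translate)
qed

end

section \<open>Matchings with labels in a countable subgroup\<close>

locale countable_subgroup_action = mp_action M act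
  for M :: "'x::polish_space measure" and act :: "'g::{polish_space, topological_group_add} \<Rightarrow> 'x \<Rightarrow> 'x" +
  fixes D :: "'g set"
  assumes countable_D: "countable D" and subgroup_D: "is_subgroup D"
begin

lemma D_zero [simp]: "0 \<in> D"
  and D_add: "g \<in> D \<Longrightarrow> h \<in> D \<Longrightarrow> g + h \<in> D"
  and D_minus: "g \<in> D \<Longrightarrow> - g \<in> D"
  using subgroup_D by (auto simp: is_subgroup_def)

definition move :: "('x \<Rightarrow> 'g) \<Rightarrow> 'x \<Rightarrow> 'x" where
  "move w x = act (w x) x"

text \<open>
  A partial injection from \<open>A\<close> to \<open>B\<close> with domain \<open>E\<close> that moves \<open>x\<close> by the label \<open>w x \<in> Q\<close>. Carrying the label
  instead of the map keeps track of the distance to a given lift.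
\<close>
definition matching :: "'g set \<Rightarrow> 'x set \<Rightarrow> 'x set \<Rightarrow> 'x set \<Rightarrow> ('x \<Rightarrow> 'g) \<Rightarrow> bool" where
  "matching Q A B E w \<longleftrightarrow> E \<in> sets M \<and> E \<subseteq> A \<and> w \<in> borel_measurable M \<and> w ` E \<subseteq> Q \<and>
     inj_on (move w) E \<and> move w ` E \<subseteq> B"

lemma measurable_move:
  assumes [measurable]: "w \<in> borel_measurable M"
  shows "move w \<in> measurable M M"
proof -
  have "(\<lambda>x. (w x, x)) \<in> measurable M (borel \<Otimes>\<^sub>M M)" by measurable
  from measurable_compose[OF this measurable_act_pair] show ?thesis
    by (simp add: move_def[abs_def])
qed

text \<open>
  With countably many labels a matching is a countable disjoint union of restrictions of
  single group elements. So it preserves measure, and images of Borel sets are Borel for an elementary reason.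
\<close>
lemma matching_image:
  assumes m: "matching Q A B E w" and Q: "countable Q" and F: "F \<in> sets M" "F \<subseteq> E"
  shows sets_move_image: "move w ` F \<in> sets M"
    and measure_move_image: "measure M (move w ` F) = measure M F"
proof -
  have [measurable]: "w \<in> borel_measurable M" and wQ: "w ` E \<subseteq> Q" and inj: "inj_on (move w) E"
    using m by (auto simp: matching_def)
  define G where "G q = {x \<in> F. w x = q}" for q
  have G[measurable]: "G q \<in> sets M" for q
  proof -
    have "G q = F \<inter> (w -` {q} \<inter> space M)" by (auto simp: G_def)
    also have "\<dots> \<in> sets M" using F by (intro sets.Int measurable_sets[of w M borel]) auto
    finally show ?thesis .
  qed
  have F_UN: "F = (\<Union>q\<in>Q. G q)" using F wQ by (auto simp: G_def)
  have mF_UN: "move w ` F = (\<Union>q\<in>Q. act q ` G q)"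
    by (subst F_UN) (auto simp: G_def move_def image_UN)
  show "move w ` F \<in> sets M" unfolding mF_UN by (intro sets.countable_UN'' Q) auto
  have "emeasure M (move w ` F) = (\<integral>\<^sup>+q. emeasure M (act q ` G q) \<partial>count_space Q)"
    unfolding mF_UN
  proof (rule emeasure_UN_countable)
    show "disjoint_family_on (\<lambda>q. act q ` G q) Q"
    proof (unfold disjoint_family_on_def, intro ballI impI, rule ccontr)
      fix p q assume "p \<noteq> q" "act p ` G p \<inter> act q ` G q \<noteq> {}"
      then obtain x y where xy: "x \<in> F" "w x = p" "y \<in> F" "w y = q" "act p x = act q y"
        by (auto simp: G_def)
      then have "move w x = move w y" by (simp add: move_def)
      then have "x = y" using inj xy F(2) by (meson inj_onD subsetD)
      then show False using xy \<open>p \<noteq> q\<close> by simp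
    qed
  qed (use Q in auto)
  also have "\<dots> = (\<integral>\<^sup>+q. emeasure M (G q) \<partial>count_space Q)"
    by (simp add: emeasure_act_image)
  also have "\<dots> = emeasure M (\<Union>q\<in>Q. G q)"
    by (rule emeasure_UN_countable[symmetric])
      (use Q G in \<open>auto simp: disjoint_family_on_def\<close>, auto simp: G_def)
  also have "\<dots> = emeasure M F" by (simp flip: F_UN)
  finally show "measure M (move w ` F) = measure M F" by (simp add: measure_def)
qed

lemma matching_Un:
  assumes "matching Q A B E w" and "matching Q (A - E) (B - move w ` E) F v"
  shows "matching Q A B (E \<union> F) (\<lambda>x. if x \<in> E then w x else v x)"
    and "move (\<lambda>x. if x \<in> E then w x else v x) ` (E \<union> F) = move w ` E \<union> move v ` F"
proof -
  let ?u = "\<lambda>x. if x \<in> E then w x else v x"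
  have E: "E \<in> sets M" "E \<subseteq> A" "w \<in> borel_measurable M" "w ` E \<subseteq> Q" "inj_on (move w) E" "move w ` E \<subseteq> B"
    and F: "F \<in> sets M" "F \<subseteq> A - E" "v \<in> borel_measurable M" "v ` F \<subseteq> Q" "inj_on (move v) F"
      "move v ` F \<subseteq> B - move w ` E"
    using assms by (auto simp: matching_def)
  have uE: "move ?u x = move w x" if "x \<in> E" for x using that by (simp add: move_def)
  have uF: "move ?u x = move v x" if "x \<in> F" for x using that F(2) by (auto simp: move_def)
  have iE: "move ?u ` E = move w ` E" and iF: "move ?u ` F = move v ` F"
    using uE uF by (auto intro!: image_cong)
  then show im: "move ?u ` (E \<union> F) = move w ` E \<union> move v ` F" by (simp add: image_Un)
  have "inj_on (move ?u) E" using E(5) uE by (simp cong: inj_on_cong)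
  moreover have "inj_on (move ?u) F" using F(5) uF by (simp cong: inj_on_cong)
  moreover have "move ?u ` E \<inter> move ?u ` F = {}" unfolding iE iF using F(6) by blast
  ultimately have inj: "inj_on (move ?u) (E \<union> F)" by (auto simp: inj_on_Un)
  show "matching Q A B (E \<union> F) ?u"
    unfolding matching_def im
  proof (intro conjI inj)
    show "?u \<in> borel_measurable M" using E F by (intro measurable_If_set) auto
    show "?u ` (E \<union> F) \<subseteq> Q" using E(4) F(4) by auto
  qed (use E F in auto)
qed

lemma matching_mono:
  assumes "matching Q A B E w" "Q \<subseteq> Q'" "A \<subseteq> A'" "B \<subseteq> B'"
  shows "matching Q' A' B' E w"
  using assms by (auto simp: matching_def)

lemma matching_empty: "matching Q A B {} (\<lambda>_. 0)"
  by (simp add: matching_def)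

text \<open>
  What is left of \<open>A\<close> and \<open>B\<close> after each of the labels \<open>q 0, \<dots>, q (n - 1)\<close> in turn has matched
  all points that it could.
\<close>
primrec greedy_rest :: "(nat \<Rightarrow> 'g) \<Rightarrow> 'x set \<Rightarrow> 'x set \<Rightarrow> nat \<Rightarrow> 'x set \<times> 'x set" where
  "greedy_rest q A B 0 = (A, B)"
| "greedy_rest q A B (Suc n) =
     (let (A', B') = greedy_rest q A B n; E = {x \<in> A'. act (q n) x \<in> B'} in (A' - E, B' - act (q n) ` E))"

text \<open>
  A single pass through the labels suffices: a point that is never matched and an unmatched target
  were both still available when the label joining them was treated.
\<close>
lemma greedy_matching:
  assumes A: "A \<in> sets M" and B: "B \<in> sets M" and Q: "countable Q"
  obtains E w where "matching Q A B E w" "\<And>q. q \<in> Q \<Longrightarrow> act q ` (A - E) \<inter> (B - move w ` E) = {}"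
proof (cases "Q = {}")
  case True
  then show ?thesis using that[of "{}" "\<lambda>_. 0"] by (simp add: matching_empty)
next
  case False
  define q where "q = from_nat_into Q"
  have q_in: "q n \<in> Q" for n using False by (simp add: q_def from_nat_into)
  define R S where "R n = fst (greedy_rest q A B n)" and "S n = snd (greedy_rest q A B n)" for n
  define F where "F n = {x \<in> R n. act (q n) x \<in> S n}" for n
  have R0: "R 0 = A" and S0: "S 0 = B" by (simp_all add: R_def S_def)
  have RSuc: "R (Suc n) = R n - F n" and SSuc: "S (Suc n) = S n - act (q n) ` F n" for n
    by (simp_all add: R_def S_def F_def Let_def split: prod.split)
  have F_sets': "F n \<in> sets M" if "R n \<in> sets M" "S n \<in> sets M" for n
  proof -
    have "F n = R n \<inter> (act (q n) -` S n \<inter> space M)" by (auto simp: F_def)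
    also have "\<dots> \<in> sets M" using that by (intro sets.Int measurable_sets[OF measurable_act])
    finally show ?thesis .
  qed
  have RS: "R n \<in> sets M \<and> S n \<in> sets M" for n
  proof (induction n)
    case (Suc n)
    then have "F n \<in> sets M" using F_sets' by blast
    then show ?case unfolding RSuc SSuc using Suc by auto
  qed (simp add: R0 S0 A B)
  then have F_sets: "F n \<in> sets M" for n using F_sets' by blast
  have Rdec: "R n \<subseteq> R m" if "m \<le> n" for m n
    by (rule lift_Suc_antimono_le[of R, OF _ that]) (auto simp: RSuc)
  have Sdec: "S n \<subseteq> S m" if "m \<le> n" for m n
    by (rule lift_Suc_antimono_le[of S, OF _ that]) (auto simp: SSuc)
  have F_less: "x \<notin> F m" if "x \<in> F n" "m < n" for x m n
    using that Rdec[of "Suc m" n] by (auto simp: F_def RSuc)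
  have F_unique: "m = n" if "x \<in> F m" "x \<in> F n" for x m n
    using that F_less by (metis linorder_neqE_nat)
  define i where "i x = (LEAST n. x \<in> F n)" for x
  define w where "w x = q (i x)" for x
  have i: "i x = n" if "x \<in> F n" for x n
    unfolding i_def using that F_unique[of x] by (metis LeastI)
  have w: "w x = q n" if "x \<in> F n" for x n using i[OF that] by (simp add: w_def)
  have [measurable]: "F n \<in> sets M" for n by (rule F_sets)
  have "w \<in> borel_measurable M"
  proof -
    have "i \<in> measurable M (count_space UNIV)" unfolding i_def by measurable
    then show ?thesis unfolding w_def by (rule measurable_compose) simp
  qed
  moreover have mw: "move w x = act (q n) x" "move w x \<in> S n" if "x \<in> F n" for x n
    using that w[OF that] by (auto simp: move_def F_def)
  moreover have inj: "inj_on (move w) (\<Union>n. F n)"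
  proof -
    have less: "move w x \<noteq> move w y" if "x \<in> F m" "y \<in> F n" "m < n" for x y m n
    proof -
      have "move w x \<in> act (q m) ` F m" using mw(1)[OF that(1)] that(1) by blast
      moreover have "move w y \<in> S (Suc m)" using mw(2)[OF that(2)] Sdec[of "Suc m" n] that(3) by auto
      ultimately show ?thesis by (auto simp: SSuc)
    qed
    show ?thesis
    proof (rule inj_onI)
      fix x y assume "x \<in> (\<Union>n. F n)" "y \<in> (\<Union>n. F n)" and eq: "move w x = move w y"
      then obtain m n where mn: "x \<in> F m" "y \<in> F n" by blast
      then have "m = n" using less eq by (metis linorder_neqE_nat)
      then show "x = y" using mw(1) mn eq inj_onD[OF inj_act[of "q n" UNIV]] by simp
    qed
  qed
  moreover have "(\<Union>n. F n) \<subseteq> A" using Rdec[of 0] by (auto simp: F_def R0)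
  moreover have "move w ` (\<Union>n. F n) \<subseteq> B" using mw(2) Sdec[of 0] by (auto simp: S0)
  moreover have "w ` (\<Union>n. F n) \<subseteq> Q" using w q_in by auto
  moreover have "(\<Union>n. F n) \<in> sets M" by measurable
  ultimately have "matching Q A B (\<Union>n. F n) w" unfolding matching_def by blast
  moreover have "act p ` (A - (\<Union>n. F n)) \<inter> (B - move w ` (\<Union>n. F n)) = {}" if p: "p \<in> Q" for p
  proof (rule ccontr)
    assume "act p ` (A - (\<Union>n. F n)) \<inter> (B - move w ` (\<Union>n. F n)) \<noteq> {}"
    then obtain x where x: "x \<in> A" "\<And>n. x \<notin> F n" "act p x \<in> B" "act p x \<notin> move w ` (\<Union>n. F n)" by auto
    obtain n where n: "p = q n" using from_nat_into_surj[OF Q p] by (auto simp: q_def)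
    have "x \<in> R k" for k by (induction k) (use x in \<open>auto simp: R0 RSuc\<close>)
    moreover have "act p x \<in> S k" for k
    proof (induction k)
      case (Suc k)
      have "act (q k) ` F k \<subseteq> move w ` (\<Union>n. F n)" using mw(1) by (auto intro!: rev_image_eqI)
      then show ?case using Suc x(4) by (auto simp: SSuc)
    qed (use x in \<open>simp add: S0\<close>)
    ultimately have "x \<in> F n" by (simp add: F_def n)
    then show False using x by blast
  qed
  ultimately show ?thesis by (rule that)
qed

lemma extend_matching:
  assumes A: "A \<in> sets M" and B: "B \<in> sets M" and Q: "countable Q" and m: "matching Q A B E w"
  obtains E' w' where "matching Q A B E' w'" "E \<subseteq> E'" "\<And>x. x \<in> E \<Longrightarrow> w' x = w x"
    "\<And>q. q \<in> Q \<Longrightarrow> act q ` (A - E') \<inter> (B - move w' ` E') = {}"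
proof -
  have "A - E \<in> sets M" "B - move w ` E \<in> sets M"
    using A B m sets_move_image[OF m Q, of E] by (auto simp: matching_def)
  then obtain F v where F: "matching Q (A - E) (B - move w ` E) F v"
    "\<And>q. q \<in> Q \<Longrightarrow> act q ` (A - E - F) \<inter> (B - move w ` E - move v ` F) = {}"
    using greedy_matching[OF _ _ Q] by metis
  let ?u = "\<lambda>x. if x \<in> E then w x else v x"
  show ?thesis
  proof (rule that[of "E \<union> F" ?u])
    show "matching Q A B (E \<union> F) ?u" by (rule matching_Un(1)[OF m F(1)])
    fix q assume "q \<in> Q"
    moreover have "A - E - F = A - (E \<union> F)"
      "B - move w ` E - move v ` F = B - (move w ` E \<union> move v ` F)" by auto
    ultimately show "act q ` (A - (E \<union> F)) \<inter> (B - move ?u ` (E \<union> F)) = {}"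
      unfolding matching_Un(2)[OF m F(1)] using F(2)[of q] by simp
  qed auto
qed

end

section \<open>Suitable actions and Hall's condition\<close>

locale suitable_action = countable_subgroup_action M act D
  for M :: "'x::polish_space measure" and act :: "'g::{polish_space, topological_group_add} \<Rightarrow> 'x \<Rightarrow> 'x"
    and D :: "'g set" +
  fixes d :: "'g \<Rightarrow> 'g \<Rightarrow> real"
  assumes suitable: "suitable M act"
    and metric: "compatible_right_invariant_bounded_metric d"
    and dense_D: "closure D = UNIV"
begin

lemma meets_D: "open U \<Longrightarrow> U \<noteq> {} \<Longrightarrow> \<exists>q\<in>D. q \<in> U"
  using dense_D open_Int_closure_eq_empty[of U D] by auto

lemma Metric_space_d: "Metric_space UNIV d"
  and mtopology_d: "Metric_space.mtopology UNIV d = euclidean"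
  and d_right_invariant: "d (g + k) (h + k) = d g h"
  using metric by (auto simp: compatible_right_invariant_bounded_metric_def)

interpretation d: Metric_space UNIV d
  by (rule Metric_space_d)

definition len :: "'g \<Rightarrow> real" where
  "len g = d g 0"

lemma len_zero [simp]: "len 0 = 0"
  by (simp add: len_def)

lemma len_nonneg [simp]: "0 \<le> len g"
  by (simp add: len_def)

lemma len_diff: "len (g - h) = d g h"
  using d_right_invariant[of "g - h" h 0] by (simp add: len_def)

lemma len_add: "len (g + h) \<le> len g + len h"
  using d.triangle[of "g + h" h 0] d_right_invariant[of g h 0] by (simp add: len_def)

lemma len_minus: "len (- g) = len g"
  using len_diff[of 0 g] by (simp add: len_def d.commute)

lemma open_len: "open {g. len g < r}"
proof -
  have "{g. len g < r} = d.mball 0 r" by (auto simp: d.mball_def len_def d.commute)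
  moreover have "openin euclidean (d.mball 0 r)"
    unfolding mtopology_d[symmetric] by (rule d.openin_mball)
  ultimately show ?thesis by simp
qed

lemma open_dist: "open {h. d g h < r}"
proof -
  have "{h. d g h < r} = d.mball g r" by (auto simp: d.mball_def)
  moreover have "openin euclidean (d.mball g r)"
    unfolding mtopology_d[symmetric] by (rule d.openin_mball)
  ultimately show ?thesis by simp
qed

text \<open>
  Each \<open>g \<in> V\<close> moves \<open>A\<close> off \<open>B\<close> up to a null set, because an exceptional \<open>g\<close> would be approximated by an
  exceptional element of \<open>D\<close>. The elements near \<open>g\<close> do so as well, hence the first alternative of suitability
  fails
  for \<open>act g ` A\<close> and \<open>B\<close>. The second alternative provides one null set that serves for a whole neighbourhood of \<open>g\<close>,
  and countably many such neighbourhoods cover \<open>V\<close>.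
\<close>
lemma suitable_separation:
  assumes A: "A \<in> sets M" and B: "B \<in> sets M" and V: "open V"
    and null: "\<And>q. q \<in> D \<Longrightarrow> q \<in> V \<Longrightarrow> measure M (act q ` A \<inter> B) = 0"
  obtains A' B' where "A' \<in> sets M" "B' \<in> sets M" "A' \<subseteq> A" "B' \<subseteq> B"
    "measure M (A - A') = 0" "measure M (B - B') = 0" "\<And>g. g \<in> V \<Longrightarrow> act g ` A' \<inter> B' = {}"
proof -
  have null': "measure M (act g ` A \<inter> B) = 0" if "g \<in> V" for g
  proof (rule ccontr)
    assume "measure M (act g ` A \<inter> B) \<noteq> 0"
    then have "g \<in> {g. 0 < measure M (act g ` A \<inter> B)} \<inter> V" using that by (simp add: zero_less_measure_iff)
    moreover have "open ({g. 0 < measure M (act g ` A \<inter> B)} \<inter> V)"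
      by (intro open_Int open_measure_pos A B V)
    ultimately obtain q where "q \<in> D" "0 < measure M (act q ` A \<inter> B)" "q \<in> V"
      using meets_D by blast
    then show False using null by simp
  qed
  consider "measure M A = 0" | "measure M B = 0" | "0 < measure M A" "0 < measure M B"
    using zero_less_measure_iff by blast
  then show ?thesis
  proof cases
    case 1
    then show ?thesis by (intro that[of "{}" B]) (use A B in auto)
  next
    case 2
    then show ?thesis by (intro that[of A "{}"]) (use A B in auto)
  next
    case 3
    have local: "\<exists>A' B' U. A' \<in> sets M \<and> B' \<in> sets M \<and> A' \<subseteq> A \<and> B' \<subseteq> B \<and> measure M (A - A') = 0 \<and>
        measure M (B - B') = 0 \<and> open U \<and> g \<in> U \<and> (\<forall>h\<in>U. act h ` A' \<inter> B' = {})" if g: "g \<in> V" for g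
    proof -
      have pos: "act g ` A \<in> sets M" "0 < emeasure M (act g ` A)" "0 < emeasure M B"
        using 3 A by (auto simp: emeasure_act_image emeasure_eq_measure)
      have not_near: "\<not> (\<forall>U. open U \<and> 0 \<in> U \<longrightarrow> (\<exists>k\<in>U. 0 < emeasure M (act g ` A \<inter> act k ` B)))"
      proof
        assume *: "\<forall>U. open U \<and> 0 \<in> U \<longrightarrow> (\<exists>k\<in>U. 0 < emeasure M (act g ` A \<inter> act k ` B))"
        have "open {k. - k + g \<in> V}"
          using open_vimage[OF V, of "\<lambda>k. - k + g"] by (simp add: vimage_def continuous_intros)
        moreover have "0 \<in> {k. - k + g \<in> V}" using g by simp
        ultimately obtain k where k: "- k + g \<in> V" "0 < emeasure M (act g ` A \<inter> act k ` B)"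
          using * by blast
        have "act (- k + g) ` A \<inter> B = act (- k) ` (act g ` A \<inter> act k ` B)"
        proof -
          have "act (- k) ` (act g ` A \<inter> act k ` B) = act (- k) ` act g ` A \<inter> act (- k) ` act k ` B"
            by (rule image_Int) (rule inj_act)
          also have "act (- k) ` act g ` A = act (- k + g) ` A" by (rule act_image_add[symmetric])
          also have "act (- k) ` act k ` B = B" by (simp add: image_image)
          finally show ?thesis by simp
        qed
        then have "measure M (act (- k + g) ` A \<inter> B) = measure M (act g ` A \<inter> act k ` B)"
          using A B by simp
        then show False using null'[OF k(1)] k(2) by (simp add: emeasure_eq_measure)
      qed
      have "\<exists>A1\<in>sets M. \<exists>B'\<in>sets M. \<exists>U. A1 \<subseteq> act g ` A \<and> emeasure M (act g ` A - A1) = 0 \<and>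
          B' \<subseteq> B \<and> emeasure M (B - B') = 0 \<and> open U \<and> 0 \<in> U \<and> (\<Union>k\<in>U. act k ` A1) \<inter> B' = {}"
        using suitable[unfolded suitable_def, THEN bspec, OF pos(1), THEN bspec, OF B, THEN mp, OF pos(2),
            THEN mp, OF pos(3)] not_near
        by - (erule disjE, erule notE, assumption, assumption)
      then obtain A1 B' U where A1: "A1 \<in> sets M" "B' \<in> sets M" "A1 \<subseteq> act g ` A" "emeasure M (act g ` A - A1) = 0"
          "B' \<subseteq> B" "emeasure M (B - B') = 0" "open U" "0 \<in> U" "(\<Union>k\<in>U. act k ` A1) \<inter> B' = {}"
        by (elim bexE exE conjE)
      have gA1: "act g ` act (- g) ` A1 = A1" and gA: "act (- g) ` act g ` A = A" by (simp_all add: image_image)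
      have "act (- g) ` A1 \<subseteq> A" using image_mono[OF A1(3), of "act (- g)"] unfolding gA .
      moreover have "measure M (A - act (- g) ` A1) = 0"
      proof -
        have "act g ` (A - act (- g) ` A1) = act g ` A - A1"
          using image_set_diff[OF inj_act[of g UNIV]] gA1 by metis
        then have "measure M (A - act (- g) ` A1) = measure M (act g ` A - A1)"
          using measure_act_image[of "A - act (- g) ` A1" g] A A1 by simp
        then show ?thesis using A1(4) by (simp add: measure_def)
      qed
      moreover have "open {h. h + - g \<in> U}" by (rule open_right_translate) fact
      moreover have "act h ` act (- g) ` A1 \<inter> B' = {}" if "h + - g \<in> U" for h
        using A1(9) that act_image_add[of h "- g" A1] by blast
      ultimately show ?thesis using A1
        by (intro exI[of _ "act (- g) ` A1"] exI[of _ B'] exI[of _ "{h. h + - g \<in> U}"])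
          (auto simp: measure_def)
    qed
    define P where "P g A' B' U \<longleftrightarrow> A' \<in> sets M \<and> B' \<in> sets M \<and> A' \<subseteq> A \<and> B' \<subseteq> B \<and> measure M (A - A') = 0 \<and>
        measure M (B - B') = 0 \<and> open U \<and> g \<in> U \<and> (\<forall>h\<in>U. act h ` A' \<inter> B' = {})" for g A' B' U
    have "\<forall>g\<in>V. \<exists>A' B' U. P g A' B' U" unfolding P_def using local by blast
    then obtain A' B' U where "\<And>g. g \<in> V \<Longrightarrow> P g (A' g) (B' g) (U g)" by metis
    then have loc: "\<And>g. g \<in> V \<Longrightarrow> A' g \<in> sets M" "\<And>g. g \<in> V \<Longrightarrow> B' g \<in> sets M"
        "\<And>g. g \<in> V \<Longrightarrow> measure M (A - A' g) = 0" "\<And>g. g \<in> V \<Longrightarrow> measure M (B - B' g) = 0"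
        "\<And>g. g \<in> V \<Longrightarrow> open (U g)" "\<And>g. g \<in> V \<Longrightarrow> g \<in> U g"
        "\<And>g h. g \<in> V \<Longrightarrow> h \<in> U g \<Longrightarrow> act h ` A' g \<inter> B' g = {}"
      by (simp_all add: P_def)
    obtain \<F> where \<F>: "\<F> \<subseteq> U ` V" "countable \<F>" "\<Union>\<F> = \<Union>(U ` V)"
      using Lindelof[of "U ` V"] loc(5) by blast
    obtain C where C: "countable C" "C \<subseteq> V" "\<F> = U ` C"
      using \<F>(1,2) countable_subset_image[of \<F> U V] by blast
    have VC: "V \<subseteq> (\<Union>g\<in>C. U g)" using \<F>(3) C(3) loc(6) by blast
    have diff: "measure M (S - (S - (\<Union>g\<in>C. S - S' g))) = 0"
      if S: "S \<in> sets M" "\<And>g. g \<in> V \<Longrightarrow> S' g \<in> sets M" "\<And>g. g \<in> V \<Longrightarrow> measure M (S - S' g) = 0" for S S'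
    proof -
      have "(\<Union>g\<in>C. S - S' g) \<in> null_sets M"
      proof (intro null_sets_UN' C)
        fix g assume "g \<in> C"
        then have "g \<in> V" using C by blast
        then show "S - S' g \<in> null_sets M" using S by (auto intro!: null_setsI simp: emeasure_eq_measure)
      qed
      moreover have "S - (S - (\<Union>g\<in>C. S - S' g)) = (\<Union>g\<in>C. S - S' g)" by blast
      ultimately show ?thesis by (simp add: measure_eq_0_null_sets)
    qed
    have meas: "S - (\<Union>g\<in>C. S - S' g) \<in> sets M"
      if "S \<in> sets M" "\<And>g. g \<in> V \<Longrightarrow> S' g \<in> sets M" for S S'
      using that C by (intro sets.Diff sets.countable_UN'') auto
    show ?thesis
    proof (rule that[of "A - (\<Union>g\<in>C. A - A' g)" "B - (\<Union>g\<in>C. B - B' g)"])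
      fix h assume "h \<in> V"
      then obtain g where g: "g \<in> C" "h \<in> U g" using VC by blast
      then have "act h ` A' g \<inter> B' g = {}" using loc(7) C by blast
      then show "act h ` (A - (\<Union>g\<in>C. A - A' g)) \<inter> (B - (\<Union>g\<in>C. B - B' g)) = {}" using g by blast
    qed (use diff[OF A loc(1,3)] diff[OF B loc(2,4)] meas[OF A loc(1)] meas[OF B loc(2)] in auto)
  qed
qed

text \<open>
  Hall's marriage condition for the graph that joins \<open>x \<in> A\<close> to \<open>act q x \<in> B\<close> if \<open>q \<in> D\<close> is shorter
  than \<open>r\<close>. It is stated for a set \<open>F\<close> of non-neighbours instead of the set of neighbours of \<open>C\<close>.
\<close>
definition hall_condition :: "real \<Rightarrow> 'x set \<Rightarrow> 'x set \<Rightarrow> bool" where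
  "hall_condition r A B \<longleftrightarrow> (\<forall>C\<in>sets M. \<forall>F\<in>sets M. C \<subseteq> A \<longrightarrow> F \<subseteq> B \<longrightarrow>
     (\<forall>q\<in>D. len q < r \<longrightarrow> measure M (act q ` C \<inter> F) = 0) \<longrightarrow> measure M C + measure M F \<le> measure M A)"

definition short :: "real \<Rightarrow> 'g set" where
  "short r = {q \<in> D. len q < r}"

lemma countable_short: "countable (short r)"
  by (rule countable_subset[OF _ countable_D]) (auto simp: short_def)

text \<open>
  Let \<open>m\<close> and \<open>m'\<close> be the unmatched measures before and after the extension of \<open>(E, w)\<close> to \<open>(E', w')\<close>. Starting with
  the points outside \<open>E'\<close>, alternately pass to all targets within distance \<open>r\<close> and back along the
  smaller matching, whose labels are shorter than \<open>s\<close>. Within \<open>K\<close> rounds no target that is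
  unmatched by \<open>w'\<close> can be reached, since maximality excludes edges up to \<open>(2K+1)s\<close>. Hence all targets
  reached are targets of the smaller matching, except for a set of measure at most \<open>m - m'\<close>. By Hall's condition every
  round increases the measure of the set of points reached by at least \<open>m' - (m - m')\<close>, and the total
  is at most the measure of \<open>A\<close>.
\<close>
lemma hall_growth:
  fixes K :: nat and r s :: real
  assumes A: "A \<in> sets M" and B: "B \<in> sets M"
    and hall: "hall_condition r A B" and AB: "measure M A = measure M B"
    and m: "matching (short s) A B E w" and rs: "0 \<le> r" "r \<le> s"
    and m': "matching Q A B E' w'" "countable Q" and ext: "E \<subseteq> E'" "\<And>x. x \<in> E \<Longrightarrow> w' x = w x"
    and max: "\<And>q. q \<in> short ((2 * K + 1) * s) \<Longrightarrow> act q ` (A - E') \<inter> (B - move w' ` E') = {}"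
  shows "K * (2 * measure M (A - E') - measure M (A - E)) \<le> measure M A"
proof -
  have E: "E \<in> sets M" "E \<subseteq> A" "w ` E \<subseteq> short s" "move w ` E \<subseteq> B" and E': "E' \<in> sets M" "E' \<subseteq> A"
      and w[measurable]: "w \<in> borel_measurable M"
    using m m' by (auto simp: matching_def)
  note imE = sets_move_image[OF m countable_short] measure_move_image[OF m countable_short]
  have same: "move w' x = move w x" if "x \<in> E" for x using ext(2)[OF that] by (simp add: move_def)
  define \<eta> where "\<eta> = measure M (A - E) - measure M (A - E')"
  have \<eta>: "measure M (E' - E) = \<eta>"
  proof -
    have "E' - E = (A - E) - (A - E')" using E' by blast
    then show ?thesis unfolding \<eta>_def using A E E' ext(1)
      by (simp, intro finite_measure_Diff) auto
  qed
  define N where "N C = (\<Union>q\<in>short r. act q ` C) \<inter> B" for C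
  \<comment> \<open>The points reached after \<open>i\<close> rounds.\<close>
  define C where "C = rec_nat (A - E') (\<lambda>_ C. (A - E') \<union> {x \<in> E. move w x \<in> N C})"
  have C0: "C 0 = A - E'" and CS: "C (Suc i) = (A - E') \<union> {x \<in> E. move w x \<in> N (C i)}" for i
    by (simp_all add: C_def)
  have N_sets: "N C \<in> sets M" if "C \<in> sets M" for C
    unfolding N_def using that B by (intro sets.Int sets.countable_UN'' countable_short) auto
  have pre_sets: "{x \<in> E. move w x \<in> S} \<in> sets M" if "S \<in> sets M" for S
  proof -
    have "{x \<in> E. move w x \<in> S} = E \<inter> (move w -` S \<inter> space M)" by auto
    also have "\<dots> \<in> sets M"
      using that E by (intro sets.Int measurable_sets[OF measurable_move[OF w]])
    finally show ?thesis .
  qed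
  have C_sets: "C i \<in> sets M" for i
    by (induction i) (auto simp: C0 CS A E' intro!: sets.Un pre_sets N_sets)
  have CA: "C i \<subseteq> A" for i using E by (cases i) (auto simp: C0 CS)
  have reach: "\<exists>a\<in>A - E'. \<exists>g\<in>D. len g \<le> 2 * real i * s \<and> x = act g a" if "x \<in> C i" for x i
    using that
  proof (induction i arbitrary: x)
    case 0
    then show ?case by (intro bexI[of _ x] bexI[of _ 0]) (auto simp: C0)
  next
    case (Suc i)
    show ?case
    proof (cases "x \<in> A - E'")
      case True
      then show ?thesis using \<open>0 \<le> r\<close> rs by (intro bexI[of _ x] bexI[of _ 0]) auto
    next
      case False
      then have x: "x \<in> E" "move w x \<in> N (C i)" using Suc by (auto simp: CS)
      then obtain q c where q: "q \<in> short r" "c \<in> C i" "move w x = act q c" by (auto simp: N_def)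
      obtain a g where a: "a \<in> A - E'" "g \<in> D" "len g \<le> 2 * real i * s" "c = act g a"
        using Suc.IH[OF q(2)] by blast
      have wx: "w x \<in> D" "len (w x) < s" using E(3) x(1) by (auto simp: short_def)
      have qr: "q \<in> D" "len q < r" using q by (auto simp: short_def)
      have "x = act (- w x) (act q c)" using q(3) by (simp add: move_def flip: q(3))
      also have "\<dots> = act (- w x + (q + g)) a" by (simp add: act_add a(4))
      finally have "x = act (- w x + (q + g)) a" .
      moreover have "- w x + (q + g) \<in> D" using wx qr a by (intro D_add D_minus)
      moreover have "len (- w x + (q + g)) \<le> 2 * real (Suc i) * s"
      proof -
        have "len (- w x + (q + g)) \<le> len (w x) + (len q + len g)"
          using len_add[of "- w x" "q + g"] len_add[of q g] by (simp add: len_minus)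
        also have "\<dots> \<le> s + (s + 2 * real i * s)" using wx qr a rs by simp
        also have "\<dots> = 2 * real (Suc i) * s" by (simp add: algebra_simps)
        finally show ?thesis .
      qed
      ultimately show ?thesis using a(1) by blast
    qed
  qed
  have miss: "N (C i) \<inter> (B - move w' ` E') = {}" if "i \<le> K" for i
  proof (rule ccontr)
    assume "N (C i) \<inter> (B - move w' ` E') \<noteq> {}"
    then obtain q c where q: "q \<in> short r" "c \<in> C i" "act q c \<in> B - move w' ` E'" by (auto simp: N_def)
    obtain a g where a: "a \<in> A - E'" "g \<in> D" "len g \<le> 2 * real i * s" "c = act g a"
      using reach[OF q(2)] by blast
    have qr: "q \<in> D" "len q < r" using q by (auto simp: short_def)
    have "0 \<le> s" using rs by linarith
    have "len (q + g) < s + 2 * real i * s" using len_add[of q g] qr a rs by linarith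
    also have "\<dots> \<le> (2 * K + 1) * s"
      using \<open>0 \<le> s\<close> that mult_right_mono[of "2 * real i" "2 * real K" s] by (simp add: algebra_simps)
    finally have "q + g \<in> short ((2 * K + 1) * s)" using qr a D_add by (simp add: short_def)
    from max[OF this] have "act (q + g) a \<notin> B - move w' ` E'" using a(1) by blast
    then show False using q(3) by (simp add: act_add a(4))
  qed
  have grow: "measure M (A - E') + (measure M (C i) - \<eta>) \<le> measure M (C (Suc i))" if "i \<le> K" for i
  proof -
    let ?N = "N (C i)" and ?G = "{x \<in> E. move w x \<in> N (C i)}"
    have [measurable]: "?N \<in> sets M" "?G \<in> sets M" using N_sets pre_sets C_sets by blast+
    have "?N \<subseteq> B" by (auto simp: N_def)
    have "measure M (C i) + measure M (B - ?N) \<le> measure M A"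
    proof (rule hall[unfolded hall_condition_def, rule_format])
      fix q assume "q \<in> D" "len q < r"
      then have "act q ` C i \<inter> (B - ?N) = {}" by (auto simp: N_def short_def)
      then show "measure M (act q ` C i \<inter> (B - ?N)) = 0" by simp
    qed (use C_sets CA B in auto)
    then have "measure M (C i) \<le> measure M ?N"
      using AB \<open>?N \<subseteq> B\<close> B by (simp add: finite_measure_Diff)
    also have "\<dots> \<le> measure M (move w ` ?G \<union> move w' ` (E' - E))"
    proof (rule finite_measure_mono)
      show "?N \<subseteq> move w ` ?G \<union> move w' ` (E' - E)"
      proof
        fix y assume y: "y \<in> ?N"
        then have "y \<in> move w' ` E'" using miss[OF that] \<open>?N \<subseteq> B\<close> by blast
        then obtain x where x: "x \<in> E'" "y = move w' x" by blast
        then show "y \<in> move w ` ?G \<union> move w' ` (E' - E)"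
          using y same[of x] by (cases "x \<in> E") auto
      qed
      show "move w ` ?G \<union> move w' ` (E' - E) \<in> sets M"
        using imE(1)[of ?G] sets_move_image[OF m', of "E' - E"] E E' by auto
    qed
    also have "\<dots> \<le> measure M (move w ` ?G) + measure M (move w' ` (E' - E))"
      using imE(1)[of ?G] sets_move_image[OF m', of "E' - E"] E E' by (intro measure_Un_le) auto
    also have "\<dots> = measure M ?G + \<eta>"
      using imE(2)[of ?G] measure_move_image[OF m', of "E' - E"] E E' \<eta> by auto
    finally have "measure M (C i) - \<eta> \<le> measure M ?G" by simp
    moreover have "measure M (C (Suc i)) = measure M (A - E') + measure M ?G"
      unfolding CS by (rule finite_measure_Union) (use A E' ext in auto)
    ultimately show ?thesis by simp
  qed
  have "real i * (measure M (A - E') - \<eta>) \<le> measure M (C i)" if "i \<le> K" for i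
    using that
  proof (induction i)
    case (Suc i)
    then show ?case using grow[of i] by (simp add: algebra_simps)
  qed simp
  then have "K * (measure M (A - E') - \<eta>) \<le> measure M (C K)" by simp
  also have "\<dots> \<le> measure M A" using CA A by (intro finite_measure_mono)
  finally show ?thesis by (simp add: \<eta>_def algebra_simps)
qed

lemma short_mono: "r \<le> s \<Longrightarrow> short r \<subseteq> short s"
  by (auto simp: short_def)

text \<open>
  The greedy extension is repeated \<open>J\<close> times, with bounds growing by the factor \<open>2K+1\<close>. By the growth
  estimate every extension halves the unmatched measure, up to \<open>\<mu>(A)/K\<close>. The proportion that
  remains does not depend on \<open>r\<close>.
\<close>
lemma almost_perfect_matching:
  fixes K J :: nat and r :: real
  assumes A: "A \<in> sets M" and B: "B \<in> sets M"
    and hall: "hall_condition r A B" and AB: "measure M A = measure M B" and "0 < K" "0 \<le> r"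
  shows "\<exists>E w. matching (short ((2 * K + 1) ^ J * r)) A B E w \<and>
      measure M (A - E) \<le> (1 / K + 1 / 2 ^ J) * measure M A"
proof (induction J)
  case 0
  have "measure M (A - {}) \<le> (1 / K + 1 / 2 ^ 0) * measure M A" by (simp add: algebra_simps)
  then show ?case using matching_empty by blast
next
  case (Suc J)
  let ?s = "(2 * K + 1) ^ J * r"
  obtain E w where m: "matching (short ?s) A B E w"
    and E: "measure M (A - E) \<le> (1 / K + 1 / 2 ^ J) * measure M A"
    using Suc by blast
  have s: "r \<le> ?s" using \<open>0 \<le> r\<close> by (simp add: mult_le_cancel_right1)
  have s': "real (2 * K + 1) * ?s = (2 * K + 1) ^ Suc J * r" by (simp add: algebra_simps)
  have "?s \<le> (2 * K + 1) ^ Suc J * r"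
    unfolding s'[symmetric] using \<open>0 \<le> r\<close> mult_right_mono[of 1 "real (2 * K + 1)" ?s] by simp
  then have "short ?s \<subseteq> short ((2 * K + 1) ^ Suc J * r)" by (rule short_mono)
  from matching_mono[OF m this] have m1: "matching (short ((2 * K + 1) ^ Suc J * r)) A B E w"
    by blast
  obtain E' w' where E': "matching (short ((2 * K + 1) ^ Suc J * r)) A B E' w'" "E \<subseteq> E'" "\<And>x. x \<in> E \<Longrightarrow> w' x = w x"
    "\<And>q. q \<in> short ((2 * K + 1) ^ Suc J * r) \<Longrightarrow> act q ` (A - E') \<inter> (B - move w' ` E') = {}"
    using extend_matching[OF A B countable_short m1] by metis
  have "K * (2 * measure M (A - E') - measure M (A - E)) \<le> measure M A"
    by (rule hall_growth[OF A B hall AB m \<open>0 \<le> r\<close> s E'(1) countable_short E'(2,3)])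
      (use E'(4) in \<open>simp_all only: s'\<close>)
  then have "2 * measure M (A - E') \<le> measure M A / K + measure M (A - E)"
    using \<open>0 < K\<close> by (simp add: field_simps)
  also have "\<dots> \<le> measure M A / K + (1 / K + 1 / 2 ^ J) * measure M A" using E by simp
  also have "\<dots> = 2 * ((1 / K + 1 / 2 ^ Suc J) * measure M A)" by (simp add: algebra_simps)
  finally show ?case using E' by (intro exI[of _ E'] exI[of _ w']) auto
qed

end

context countable_subgroup_action
begin

section \<open>Completing a matching to a bijection\<close>

definition saturation :: "'x set \<Rightarrow> 'x set" where
  "saturation A = (\<Union>q\<in>D. act q ` A)"

lemma sets_saturation [simp]: "A \<in> sets M \<Longrightarrow> saturation A \<in> sets M"
  unfolding saturation_def using countable_D by (intro sets.countable_UN'') auto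

lemma subset_saturation: "A \<subseteq> saturation A"
proof
  fix x assume "x \<in> A"
  then show "x \<in> saturation A"
    unfolding saturation_def by (intro UN_I[OF D_zero]) simp
qed

lemma saturation_invariant:
  assumes "q \<in> D"
  shows "act q x \<in> saturation A \<longleftrightarrow> x \<in> saturation A"
proof -
  have *: "act q x \<in> saturation A" if q: "q \<in> D" and x: "x \<in> saturation A" for q x
  proof -
    obtain p a where "p \<in> D" "a \<in> A" "x = act p a" using x by (auto simp: saturation_def)
    then have "q + p \<in> D" "act q x = act (q + p) a" using D_add q by (auto simp: act_add)
    then show ?thesis using \<open>a \<in> A\<close> by (auto simp: saturation_def)
  qed
  show ?thesis using *[of q x] *[of "- q" "act q x"] assms D_minus by auto
qed

lemma null_saturation:
  assumes "A \<in> null_sets M" shows "saturation A \<in> null_sets M"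
  unfolding saturation_def
proof (intro null_sets_UN' countable_D)
  fix q show "act q ` A \<in> null_sets M"
    using emeasure_act_image[of A q] null_setsD1[OF assms] null_setsD2[OF assms] by (intro null_setsI) auto
qed

lemma null_complement_iff: "A \<in> sets M \<Longrightarrow> measure M (- A) = 0 \<longleftrightarrow> measure M A = 1"
  using prob_compl[of A] by (auto simp: Compl_eq_Diff_UNIV)

text \<open>
  Let \<open>Z\<close> be the saturation of the points that remain unmatched after a greedy extension with all
  labels in \<open>D\<close>. Every point of \<open>Z\<close> is a target, and matchings preserve the invariant set \<open>Z\<close>, so that the matched
  part of \<open>Z\<close> is as large as \<open>Z\<close>; the unmatched part is therefore null.
\<close>
lemma complete_matching:
  assumes m: "matching D UNIV UNIV E w"
  obtains E' w' where "matching D UNIV UNIV E' w'" "E \<subseteq> E'" "\<And>x. x \<in> E \<Longrightarrow> w' x = w x"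
    "- E' \<in> null_sets M" "- move w' ` E' \<in> null_sets M"
proof -
  have U: "(UNIV :: 'x set) \<in> sets M" using sets.top[of M] by simp
  obtain E' w' where m': "matching D UNIV UNIV E' w'" and ext: "E \<subseteq> E'" "\<And>x. x \<in> E \<Longrightarrow> w' x = w x"
    and max: "\<And>q. q \<in> D \<Longrightarrow> act q ` (UNIV - E') \<inter> (UNIV - move w' ` E') = {}"
    using extend_matching[OF U U countable_D m] by metis
  have E': "E' \<in> sets M" "w' ` E' \<subseteq> D" using m' by (auto simp: matching_def)
  note im = sets_move_image[OF m' countable_D] measure_move_image[OF m' countable_D]
  define Z where "Z = saturation (- E')"
  have mE': "- E' \<in> sets M" using E'(1) U by (simp add: Compl_eq_Diff_UNIV)
  then have Z: "Z \<in> sets M" by (simp add: Z_def)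
  have "Z \<subseteq> move w' ` E'" using max by (auto simp: Z_def saturation_def Compl_eq_Diff_UNIV)
  moreover have "move w' x \<in> Z \<longleftrightarrow> x \<in> Z" if "x \<in> E'" for x
    using that E'(2) saturation_invariant[of "w' x" x "- E'"] unfolding Z_def move_def by blast
  ultimately have "Z = move w' ` (E' \<inter> Z)" by blast
  then have "measure M Z = measure M (E' \<inter> Z)" using im(2)[of "E' \<inter> Z"] E' Z by auto
  moreover have "measure M Z = measure M (E' \<inter> Z) + measure M (- E')"
  proof -
    have "Z = (E' \<inter> Z) \<union> - E'" using subset_saturation[of "- E'"] by (auto simp: Z_def)
    then have "measure M Z = measure M ((E' \<inter> Z) \<union> - E')" by simp
    also have "\<dots> = measure M (E' \<inter> Z) + measure M (- E')"
      using E' Z mE' by (intro finite_measure_Union) auto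
    finally show ?thesis .
  qed
  ultimately have 0: "measure M (- E') = 0" by simp
  then have "measure M (move w' ` E') = 1" using im(2)[of E'] E' null_complement_iff by simp
  then have "measure M (- move w' ` E') = 0" using im(1)[of E'] E' null_complement_iff by simp
  moreover have "- move w' ` E' \<in> sets M" using im(1)[of E'] E' U by (simp add: Compl_eq_Diff_UNIV)
  ultimately show ?thesis using 0 mE' ext m'
    by (intro that[of E' w']) (auto intro!: null_setsI simp: emeasure_eq_measure)
qed

text \<open>
  Membership in \<open>Aut(X,\<mu>)\<close> asks for a genuine bijection. The matching is replaced by the identity on a null
  set that is invariant under \<open>D\<close> and contains all unmatched points and targets; such a set is
  preserved by every map with labels in \<open>D\<close>.
\<close>
lemma realize_matching:
  assumes m: "matching D UNIV UNIV E w"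
    and null: "- E \<in> null_sets M" "- move w ` E \<in> null_sets M"
  obtains u where "u \<in> borel_measurable M" "range u \<subseteq> D" "move u \<in> mp_bijections M" "AE x in M. u x = w x"
proof -
  define N where "N = saturation (- E \<union> - move w ` E)"
  have N: "N \<in> null_sets M" unfolding N_def using null by (intro null_saturation null_sets.Un) auto
  have sub: "- E \<subseteq> N" "- move w ` E \<subseteq> N" using subset_saturation[of "- E \<union> - move w ` E"] by (auto simp: N_def)
  have [measurable]: "w \<in> borel_measurable M" and w: "w ` E \<subseteq> D" "inj_on (move w) E"
    using m by (auto simp: matching_def)
  define u where "u x = (if x \<in> N then 0 else w x)" for x
  have u[measurable]: "u \<in> borel_measurable M"
    unfolding u_def using N by (intro measurable_If_set) auto
  have uD: "u x \<in> D" for x using sub(1) w(1) by (auto simp: u_def)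
  have inN: "move u x \<in> N \<longleftrightarrow> x \<in> N" for x
    unfolding move_def N_def by (rule saturation_invariant) (rule uD)
  have onN: "move u x = x" if "x \<in> N" for x using that by (simp add: u_def move_def)
  have offN: "move u x = move w x" if "x \<notin> N" for x using that by (simp add: u_def move_def)
  have inj: "inj (move u)"
  proof (rule injI)
    fix x y assume eq: "move u x = move u y"
    then have "x \<in> N \<longleftrightarrow> y \<in> N" using inN by metis
    then show "x = y"
      using eq onN offN w(2) sub(1) by (cases "x \<in> N") (auto dest: inj_onD)
  qed
  have surj: "\<exists>x. y = move u x" for y
  proof (cases "y \<in> N")
    case True then show ?thesis using onN by metis
  next
    case False
    then obtain x where x: "x \<in> E" "y = move w x" using sub(2) by blast
    have "w x \<in> D" using w x by blast
    then have "x \<notin> N" using False x(2) saturation_invariant[of "w x" x] by (simp add: N_def move_def)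
    then show ?thesis using offN x by metis
  qed
  have bij: "bij (move u)" using inj surj by (auto simp: bij_def surj_def)
  have mU: "matching D UNIV UNIV UNIV u"
    using uD u inj sets.top[of M] by (auto simp: matching_def)
  have "emeasure M (move u -` A) = emeasure M A" if A: "A \<in> sets M" for A
  proof -
    have "move u -` A \<in> sets M" using measurable_sets[OF measurable_move[OF u] A] by simp
    then have "measure M (move u ` (move u -` A)) = measure M (move u -` A)"
      by (rule measure_move_image[OF mU countable_D]) simp
    moreover have "move u ` (move u -` A) = A" using bij by (simp add: bij_is_surj surj_image_vimage_eq)
    ultimately show ?thesis by (simp add: emeasure_eq_measure)
  qed
  then have "move u \<in> mp_bijections M"
    using measurable_move[OF u] bij by (simp add: mp_bijections_def)
  moreover have "AE x in M. u x = w x"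
    by (rule AE_I'[OF N]) (auto simp: u_def)
  ultimately show ?thesis using that u uD by blast
qed

end

context mp_action
begin

section \<open>Lifts and inverses by selection\<close>

text \<open>
  Up to a null set, this replaces the theorem of Lusin and Souslin that the inverse of a
  Borel bijection is Borel.
\<close>
lemma almost_everywhere_inverse:
  assumes T: "T \<in> mp_bijections M"
  shows "\<exists>g\<in>measurable M M. AE y in M. T (g y) = y"
proof -
  have T_meas: "T \<in> measurable M M" and T_bij: "bij T" using T by (auto simp: mp_bijections_def)
  have [measurable]: "T \<in> borel_measurable borel" using T_meas sets_M by (simp cong: measurable_cong_sets)
  have "{p \<in> space (borel \<Otimes>\<^sub>M borel). dist (T (snd p)) (fst p) = 0} \<in> sets (borel \<Otimes>\<^sub>M borel)" by measurable
  then have "{p. T (snd p) = fst p} \<in> sets (borel :: ('x \<times> 'x) measure)"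
    unfolding borel_prod by simp
  moreover have "\<exists>x. (y, x) \<in> {p. T (snd p) = fst p}" for y
    using bij_is_surj[OF T_bij] by (auto simp: surj_def) metis
  ultimately obtain g where g: "g \<in> borel_measurable M" "AE y in M. (y, g y) \<in> {p. T (snd p) = fst p}"
    using measurable_selection[OF prob_space_axioms sets_M] by blast
  then have "g \<in> measurable M M" using sets_M by (simp cong: measurable_cong_sets)
  then show ?thesis using g(2) by auto
qed

lemma orbit_lift:
  assumes T: "T \<in> measurable M M" and orb: "\<And>x. \<exists>g. T x = act g x"
  shows "\<exists>f\<in>borel_measurable M. AE x in M. T x = act (f x) x"
proof -
  have [measurable]: "T \<in> borel_measurable borel" using T sets_M by (simp cong: measurable_cong_sets)
  have act_eq: "(\<lambda>(g, x). act g x) \<in> borel_measurable (borel \<Otimes>\<^sub>M borel)"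
    using measurable_act_pair sets_M by (simp cong: measurable_cong_sets sets_pair_measure_cong)
  have [measurable]: "(\<lambda>p :: 'x \<times> 'g. act (snd p) (fst p)) \<in> borel_measurable (borel \<Otimes>\<^sub>M borel)"
  proof -
    have "(\<lambda>p :: 'x \<times> 'g. (snd p, fst p)) \<in> measurable (borel \<Otimes>\<^sub>M borel) (borel \<Otimes>\<^sub>M borel)" by measurable
    from measurable_compose[OF this act_eq] show ?thesis by simp
  qed
  have "{p \<in> space (borel \<Otimes>\<^sub>M borel). dist (T (fst p)) (act (snd p) (fst p)) = 0} \<in> sets (borel \<Otimes>\<^sub>M borel)" by measurable
  then have "{p. T (fst p) = act (snd p) (fst p)} \<in> sets (borel :: ('x \<times> 'g) measure)"
    unfolding borel_prod by simp
  moreover have "\<exists>g. (x, g) \<in> {p. T (fst p) = act (snd p) (fst p)}" for x using orb by simp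
  ultimately obtain f where "f \<in> borel_measurable M" "AE x in M. (x, f x) \<in> {p. T (fst p) = act (snd p) (fst p)}"
    using measurable_selection[OF prob_space_axioms sets_M] by blast
  then show ?thesis by auto
qed

end

context suitable_action
begin

interpretation d: Metric_space UNIV d
  by (rule Metric_space_d)

section \<open>Approximating elements of the full group\<close>

text \<open>
  For \<open>x \<in> A\<close> the point \<open>T x\<close> differs from \<open>act h x\<close> by \<open>f x - h\<close>, which is shorter than \<open>r\<close> by
  right invariance. If the short elements of \<open>D\<close> move \<open>C\<close> off \<open>F\<close>, then after removal of null sets
  \<open>T\<close> cannot map a point of \<open>act (- h) ` C\<close> into \<open>F\<close>, so this set and \<open>T -` F\<close> are disjoint subsets of \<open>A\<close>.
\<close>
lemma hall_piece:
  assumes f: "\<And>x. x \<in> A \<Longrightarrow> T x = act (f x) x \<and> d (f x) h < r"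
    and A: "A \<in> sets M" and T: "T \<in> measurable M M" "\<And>F. F \<in> sets M \<Longrightarrow> measure M (T -` F) = measure M F"
    and B: "T -` B \<subseteq> A"
  shows "hall_condition r (act h ` A) B"
  unfolding hall_condition_def
proof (intro ballI impI)
  fix C F assume CF: "C \<in> sets M" "F \<in> sets M" "C \<subseteq> act h ` A" "F \<subseteq> B"
    and null: "\<forall>q\<in>D. len q < r \<longrightarrow> measure M (act q ` C \<inter> F) = 0"
  obtain C' F' where C': "C' \<in> sets M" "F' \<in> sets M" "C' \<subseteq> C" "F' \<subseteq> F"
    "measure M (C - C') = 0" "measure M (F - F') = 0"
    "\<And>g. g \<in> {g. len g < r} \<Longrightarrow> act g ` C' \<inter> F' = {}"
    using suitable_separation[OF CF(1,2) open_len] null by (metis mem_Collect_eq)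
  have C'A: "act (- h) ` C' \<subseteq> A"
  proof -
    have "act (- h) ` C' \<subseteq> act (- h) ` act h ` A" using C'(3) CF(3) by blast
    then show ?thesis by (simp add: image_image)
  qed
  have "act (- h) ` C' \<inter> T -` F' = {}"
  proof (rule ccontr)
    assume "act (- h) ` C' \<inter> T -` F' \<noteq> {}"
    then obtain c where c: "c \<in> C'" "T (act (- h) c) \<in> F'" by auto
    let ?x = "act (- h) c"
    have "T ?x = act (f ?x) ?x" "d (f ?x) h < r" using f C'A c by blast+
    moreover have "act (f ?x) ?x = act (f ?x - h) c"
      by (simp add: diff_conv_add_uminus flip: act_add del: add_uminus_conv_diff)
    ultimately have "act (f ?x - h) c \<in> act (f ?x - h) ` C' \<inter> F'" "len (f ?x - h) < r"
      using c by (auto simp: len_diff)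
    then show False using C'(7) by blast
  qed
  moreover have TF: "T -` F' \<in> sets M" using measurable_sets[OF T(1) C'(2)] by simp
  ultimately have "measure M (act (- h) ` C') + measure M (T -` F') = measure M (act (- h) ` C' \<union> T -` F')"
    using C' by (intro finite_measure_Union[symmetric]) auto
  also have "\<dots> \<le> measure M A"
  proof (rule finite_measure_mono[OF _ A])
    have "T -` F' \<subseteq> T -` B" using C'(4) CF(4) by blast
    then show "act (- h) ` C' \<union> T -` F' \<subseteq> A" using C'A B by blast
  qed
  finally have "measure M C' + measure M F' \<le> measure M A" using C' T(2) by simp
  moreover have "measure M C = measure M C'" "measure M F = measure M F'"
    using finite_measure_Diff[of C C'] finite_measure_Diff[of F F'] C' CF by auto
  ultimately show "measure M C + measure M F \<le> measure M (act h ` A)" using A by simp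
qed

text \<open>
  The matchings of the translated pieces \<open>act h ` A\<close> with the targets \<open>B\<close> are put together, the label on a
  piece being composed with \<open>h\<close>. As the targets of distinct pieces are disjoint,
  this is again a matching. The unmatched proportion is the same bound \<open>\<nu>\<close> on every piece, and
  so bounds the total.
\<close>
lemma matching_near_transformation:
  assumes T: "T \<in> mp_bijections M" and f: "f \<in> borel_measurable M" "AE x in M. T x = act (f x) x"
    and "0 < \<eta>"
  obtains F v where "matching D UNIV UNIV F v" "measure M (- F) \<le> \<eta>" "\<And>x. x \<in> F \<Longrightarrow> d (f x) (v x) \<le> \<eta>"
proof -
  obtain K :: nat where K: "2 / \<eta> < K" using reals_Archimedean2 by blast
  have "0 < 2 / \<eta>" using \<open>0 < \<eta>\<close> by simp
  then have K0: "0 < K" using K by (metis of_nat_0_less_iff order.strict_trans)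
  define \<nu> where "\<nu> = 1 / real K + 1 / 2 ^ K"
  have "0 \<le> \<nu>" by (simp add: \<nu>_def)
  have "1 / 2 ^ K \<le> 1 / real K"
    using K0 of_nat_less_two_power[of K, where 'a = real] by (intro divide_left_mono) auto
  then have "\<nu> \<le> 2 / K" by (simp add: \<nu>_def)
  also have "2 / K \<le> \<eta>" using K K0 \<open>0 < \<eta>\<close> by (simp add: field_simps)
  finally have "\<nu> \<le> \<eta>" .
  \<comment> \<open>The radius \<open>r\<close> of the pieces is such that after \<open>K\<close> stages the labels are still shorter than \<open>\<delta>\<close>.\<close>
  define \<delta> where "\<delta> = \<eta> / 2"
  have "0 < \<delta>" using \<open>0 < \<eta>\<close> by (simp add: \<delta>_def)
  define r where "r = \<delta> / (2 * K + 1) ^ K"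
  have "0 < r" using \<open>0 < \<delta>\<close> by (simp add: r_def)
  have r\<delta>: "(2 * K + 1) ^ K * r = \<delta>" by (simp add: r_def)
  have "r \<le> \<delta>"
  proof -
    have "1 * r \<le> (2 * K + 1) ^ K * r" using \<open>0 < r\<close> by (intro mult_right_mono) auto
    then show ?thesis using r\<delta> by simp
  qed

  have T_meas[measurable]: "T \<in> measurable M M" and T_bij: "bij T"
    and T_mp: "\<And>F. F \<in> sets M \<Longrightarrow> measure M (T -` F) = measure M F"
    using T by (auto simp: mp_bijections_def measure_def)
  obtain N0 where N0: "N0 \<in> null_sets M" "\<And>x. x \<notin> N0 \<Longrightarrow> T x = act (f x) x"
    using f(2) by (auto simp: eventually_ae_filter)
  obtain g where g[measurable]: "g \<in> measurable M M" and "AE y in M. T (g y) = y"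
    using almost_everywhere_inverse[OF T] by blast
  then obtain N1 where N1: "N1 \<in> null_sets M" "\<And>y. y \<notin> N1 \<Longrightarrow> T (g y) = y"
    by (auto simp: eventually_ae_filter)
  have [measurable]: "N0 \<in> sets M" "N1 \<in> sets M" using N0 N1 by auto

  define h where "h = from_nat_into D"
  have "D \<noteq> {}" using D_zero by blast
  then have h: "h n \<in> D" for n unfolding h_def by (rule from_nat_into)
  have dense_h: "\<exists>n. d k (h n) < r" for k
  proof -
    have "k \<in> {l. d k l < r}" using \<open>0 < r\<close> by simp
    then obtain q where "q \<in> D" "d k q < r" using meets_D[OF open_dist[of k r]] by blast
    then show ?thesis using from_nat_into_surj[OF countable_D] by (metis h_def)
  qed
  define i where "i x = (LEAST n. d (f x) (h n) < r)" for x
  have i: "d (f x) (h (i x)) < r" for x unfolding i_def using dense_h by (rule LeastI_ex)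
  have [measurable]: "i \<in> measurable M (count_space UNIV)"
  proof -
    have [measurable]: "(\<lambda>x. d (f x) (h n)) \<in> borel_measurable M" for n
      using metric_measurable[OF Metric_space_d mtopology_d f(1)] by simp
    show ?thesis unfolding i_def by measurable
  qed
  define A where "A n = {x \<in> space M. x \<notin> N0 \<and> i x = n}" for n
  \<comment> \<open>\<open>T ` A n\<close> up to a null set, made measurable by the inverse \<open>g\<close>.\<close>
  define B where "B n = {y \<in> space M. y \<notin> N1 \<and> g y \<in> A n}" for n
  have A[measurable]: "A n \<in> sets M" for n unfolding A_def by measurable
  have B[measurable]: "B n \<in> sets M" for n unfolding B_def by measurable
  have TB: "T -` B n \<subseteq> A n" for n
  proof
    fix x assume "x \<in> T -` B n"
    then have "T (g (T x)) = T x" "g (T x) \<in> A n" using N1 by (auto simp: B_def)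
    then show "x \<in> A n" using T_bij by (metis bij_is_inj injD)
  qed
  have AB: "measure M (A n) = measure M (B n)" for n
  proof -
    have "A n - T -` N1 \<subseteq> T -` B n"
    proof
      fix x assume x: "x \<in> A n - T -` N1"
      then have "g (T x) = x" using N1(2)[of "T x"] T_bij by (metis Diff_iff bij_is_inj injD vimageI)
      then show "x \<in> T -` B n" using x by (auto simp: B_def)
    qed
    moreover have "T -` N1 \<in> sets M" using measurable_sets[OF T_meas, of N1] by simp
    moreover have "T -` B n \<in> sets M" using measurable_sets[OF T_meas B[of n]] by simp
    ultimately have "measure M (A n) \<le> measure M (T -` B n \<union> T -` N1)"
      by (intro finite_measure_mono) auto
    also have "\<dots> \<le> measure M (T -` B n) + measure M (T -` N1)"
      using measurable_sets[OF T_meas, of N1] measurable_sets[OF T_meas B[of n]] by (intro measure_Un_le) auto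
    also have "\<dots> = measure M (B n)" using N1(1) by (simp add: T_mp measure_eq_0_null_sets)
    finally have "measure M (A n) \<le> measure M (B n)" .
    moreover have "measure M (T -` B n) \<le> measure M (A n)" using TB by (intro finite_measure_mono) auto
    ultimately show ?thesis by (simp add: T_mp)
  qed
  have hall: "hall_condition r (act (h n) ` A n) (B n)" for n
    by (rule hall_piece[where T = T and f = f]) (use N0 i A T_mp TB in \<open>auto simp: A_def\<close>)
  have "\<exists>E w. matching (short \<delta>) (act (h n) ` A n) (B n) E w \<and>
      measure M (act (h n) ` A n - E) \<le> \<nu> * measure M (A n)" for n
  proof -
    have "measure M (act (h n) ` A n) = measure M (B n)" using AB by simp
    from almost_perfect_matching[OF sets_act_image[OF A] B hall this K0 less_imp_le[OF \<open>0 < r\<close>], of K]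
    show ?thesis unfolding r\<delta> \<nu>_def by auto
  qed
  then obtain E w where m: "\<And>n. matching (short \<delta>) (act (h n) ` A n) (B n) (E n) (w n)"
    and small: "\<And>n. measure M (act (h n) ` A n - E n) \<le> \<nu> * measure M (A n)"
    by metis
  have E: "E n \<in> sets M" "E n \<subseteq> act (h n) ` A n" "w n ` E n \<subseteq> short \<delta>" "inj_on (move (w n)) (E n)"
      "move (w n) ` E n \<subseteq> B n" and w[measurable]: "w n \<in> borel_measurable M" for n
    using m[of n] by (auto simp: matching_def)

  define F where "F n = act (- h n) ` E n" for n
  have F[measurable]: "F n \<in> sets M" for n using E by (simp add: F_def)
  have FA: "F n \<subseteq> A n" for n
  proof -
    have "F n \<subseteq> act (- h n) ` act (h n) ` A n" unfolding F_def using E(2) by blast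
    then show ?thesis by (simp add: image_image)
  qed
  have FE: "act (h n) x \<in> E n" if "x \<in> F n" for x n using that by (auto simp: F_def)
  have Fi: "i x = n" if "x \<in> F n" for x n using that FA by (auto simp: A_def)
  define v where "v x = w (i x) (act (h (i x)) x) + h (i x)" for x
  have v_F: "move v x = move (w n) (act (h n) x)" "v x = w n (act (h n) x) + h n" if "x \<in> F n" for x n
    using Fi[OF that] by (simp_all add: move_def v_def act_add)
  have v[measurable]: "v \<in> borel_measurable M"
    unfolding v_def
  proof (rule measurable_compose_countable[of "\<lambda>n x. w n (act (h n) x) + h n"])
    fix n
    have "(\<lambda>x. w n (act (h n) x)) \<in> borel_measurable M"
      using measurable_compose[OF measurable_act w] by simp
    moreover have "(\<lambda>k. k + h n) \<in> borel_measurable borel"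
      by (intro borel_measurable_continuous_onI continuous_intros)
    ultimately show "(\<lambda>x. w n (act (h n) x) + h n) \<in> borel_measurable M"
      by (rule measurable_compose)
  qed measurable
  have B_disj: "m = n" if "y \<in> B m" "y \<in> B n" for y m n using that by (auto simp: B_def A_def)
  have mv: "matching D UNIV UNIV (\<Union>n. F n) v"
    unfolding matching_def
  proof (intro conjI)
    show "v ` (\<Union>n. F n) \<subseteq> D"
    proof (safe)
      fix x n assume x: "x \<in> F n"
      then have "w n (act (h n) x) \<in> D" using E(3) FE[OF x] by (auto simp: short_def)
      then show "v x \<in> D" using v_F(2)[OF x] h D_add by simp
    qed
    show "inj_on (move v) (\<Union>n. F n)"
    proof (rule inj_onI)
      fix x y assume "x \<in> (\<Union>n. F n)" "y \<in> (\<Union>n. F n)" and eq: "move v x = move v y"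
      then obtain m n where mn: "x \<in> F m" "y \<in> F n" by blast
      have "move v x \<in> B m" "move v y \<in> B n"
        using v_F(1)[OF mn(1)] v_F(1)[OF mn(2)] FE[OF mn(1)] FE[OF mn(2)] E(5) by auto
      then have "m = n" using B_disj eq by simp
      then have y: "y \<in> F m" using mn(2) by simp
      have "act (h m) x = act (h m) y"
      proof (rule inj_onD[OF E(4)[of m]])
        show "move (w m) (act (h m) x) = move (w m) (act (h m) y)"
          using eq unfolding v_F(1)[OF mn(1)] v_F(1)[OF y] .
      qed (rule FE, fact)+
      then show "x = y" using inj_onD[OF inj_act[of "h m" UNIV]] by simp
    qed
  qed auto
  have bad: "measure M (- (\<Union>n. F n)) \<le> \<nu>"
  proof -
    have disjA: "disjoint_family A" by (auto simp: disjoint_family_on_def A_def)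
    then have disj: "disjoint_family (\<lambda>n. A n - F n)" by (auto simp: disjoint_family_on_def)
    have le: "measure M (A n - F n) \<le> \<nu> * measure M (A n)" for n
    proof -
      have "act (h n) ` (A n - F n) = act (h n) ` A n - act (h n) ` F n"
        by (rule image_set_diff) (rule inj_act)
      also have "act (h n) ` F n = E n" by (simp add: F_def image_image)
      finally have "measure M (A n - F n) = measure M (act (h n) ` A n - E n)"
        using measure_act_image[of "A n - F n" "h n"] by simp
      then show ?thesis using small[of n] by simp
    qed
    have s1: "(\<lambda>n. measure M (A n - F n)) sums measure M (\<Union>n. A n - F n)"
      by (intro finite_measure_UNION disj) auto
    have s2: "(\<lambda>n. \<nu> * measure M (A n)) sums (\<nu> * measure M (\<Union>n. A n))"
      by (intro sums_mult finite_measure_UNION disjA) auto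
    have "measure M (\<Union>n. A n - F n) \<le> \<nu> * measure M (\<Union>n. A n)"
      by (rule sums_le[OF le s1 s2])
    also have "\<dots> \<le> \<nu>" using \<open>0 \<le> \<nu>\<close> prob_le_1 by (simp add: mult_left_le)
    finally have le\<nu>: "measure M (\<Union>n. A n - F n) \<le> \<nu>" .
    have "- (\<Union>n. F n) \<subseteq> (\<Union>n. A n - F n) \<union> N0" by (auto simp: A_def)
    then have "measure M (- (\<Union>n. F n)) \<le> measure M ((\<Union>n. A n - F n) \<union> N0)"
      by (intro finite_measure_mono) auto
    also have "\<dots> \<le> measure M (\<Union>n. A n - F n) + measure M N0" by (intro measure_Un_le) auto
    also have "measure M N0 = 0" using N0(1) by (simp add: measure_eq_0_null_sets)
    finally show ?thesis using le\<nu> by simp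
  qed
  have near: "d (f x) (v x) \<le> \<eta>" if "x \<in> (\<Union>n. F n)" for x
  proof -
    obtain n where x: "x \<in> F n" using \<open>x \<in> (\<Union>n. F n)\<close> by blast
    let ?w = "w n (act (h n) x)"
    have "d (f x) (v x) = d (f x - h n + h n) (?w + h n)" by (simp add: v_F(2)[OF x])
    also have "\<dots> = d (f x - h n) ?w" by (rule d_right_invariant)
    also have "\<dots> \<le> d (f x - h n) 0 + d 0 ?w" by (rule d.triangle) auto
    also have "\<dots> = d (f x) (h n) + len ?w" using len_diff[of "f x" "h n"] by (simp add: len_def d.commute)
    finally have "d (f x) (v x) \<le> d (f x) (h n) + len ?w" .
    moreover have "d (f x) (h n) < r" using i[of x] Fi[OF x] by simp
    moreover have "?w \<in> short \<delta>" using E(3)[of n] FE[OF x] by blast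
    then have "len ?w < \<delta>" by (simp add: short_def)
    ultimately show ?thesis using \<open>r \<le> \<delta>\<close> unfolding \<delta>_def by linarith
  qed
  show ?thesis by (rule that[OF mv _ near]) (use bad \<open>\<nu> \<le> \<eta>\<close> in simp)
qed

text \<open>
  On the completion of the matching nothing is known about the distance to \<open>f\<close> except for the bound \<open>C\<close> of the
  metric, but the completion only concerns a set of small measure.
\<close>
lemma approximate_by_subgroup:
  assumes T: "T \<in> mp_bijections M" and f: "f \<in> borel_measurable M" "AE x in M. T x = act (f x) x"
    and "0 < \<epsilon>"
  obtains u where "u \<in> borel_measurable M" "range u \<subseteq> D" "move u \<in> mp_bijections M"
    "(LINT x|M. d (f x) (u x)) < \<epsilon>"
proof -
  obtain C where C: "0 < C" "\<And>g h. d g h \<le> C"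
  proof -
    obtain C where "\<And>g h. d g h \<le> C"
      using metric by (auto simp: compatible_right_invariant_bounded_metric_def)
    then show ?thesis by (intro that[of "max C 1"]) (auto simp: le_max_iff_disj)
  qed
  define \<eta> where "\<eta> = \<epsilon> / 2 / (1 + C)"
  have "1 + C \<noteq> 0" using C by linarith
  then have "(1 + C) * \<eta> = \<epsilon> / 2"
    unfolding \<eta>_def by (metis nonzero_mult_div_cancel_left times_divide_eq_right)
  moreover have "0 < \<eta>" using C \<open>0 < \<epsilon>\<close> by (simp add: \<eta>_def)
  ultimately have \<eta>: "0 < \<eta>" "\<eta> + C * \<eta> < \<epsilon>"
    using \<open>0 < \<epsilon>\<close> by (simp_all add: distrib_right)
  obtain F v where mv: "matching D UNIV UNIV F v" and bad: "measure M (- F) \<le> \<eta>"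
    and near: "\<And>x. x \<in> F \<Longrightarrow> d (f x) (v x) \<le> \<eta>"
    using matching_near_transformation[OF T f \<eta>(1)] by metis
  have "F \<in> sets M" using mv by (simp add: matching_def)
  then have "- F \<in> sets M"
    using sets.compl_sets[of F M] by (simp add: Compl_eq_Diff_UNIV)
  then have int: "integrable M (indicat_real (- F))"
    by (intro integrable_real_indicator) (auto simp: emeasure_eq_measure)
  obtain E' w' where m': "matching D UNIV UNIV E' w'" "\<And>x. x \<in> F \<Longrightarrow> w' x = v x"
      "- E' \<in> null_sets M" "- move w' ` E' \<in> null_sets M"
    using complete_matching[OF mv] by metis
  obtain u where u: "u \<in> borel_measurable M" "range u \<subseteq> D" "move u \<in> mp_bijections M" "AE x in M. u x = w' x"
    using realize_matching[OF m'(1,3,4)] by metis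
  have meas: "(\<lambda>x. d (f x) (u x)) \<in> borel_measurable M"
    by (rule metric_measurable[OF Metric_space_d mtopology_d f(1) u(1)])
  have "(LINT x|M. d (f x) (u x)) \<le> (LINT x|M. \<eta> + C * indicator (- F) x)"
  proof (rule integral_mono_AE)
    show "integrable M (\<lambda>x. d (f x) (u x))"
      using meas C(2) by (intro integrable_const_bound[where B = C]) auto
    show "integrable M (\<lambda>x. \<eta> + C * indicator (- F) x)"
      by (intro Bochner_Integration.integrable_add integrable_mult_right int) simp
    show "AE x in M. d (f x) (u x) \<le> \<eta> + C * indicator (- F) x"
      using u(4)
    proof eventually_elim
      case (elim x)
      show ?case
      proof (cases "x \<in> F")
        case True
        then show ?thesis using near[OF True] elim m'(2)[OF True] by simp
      next
        case False
        then show ?thesis using C(2)[of "f x" "u x"] \<eta>(1) by (simp add: indicator_def)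
      qed
    qed
  qed
  also have "\<dots> = \<eta> + C * measure M (- F)"
    by (subst Bochner_Integration.integral_add) (use int prob_space in simp_all)
  also have "\<dots> \<le> \<eta> + C * \<eta>" using bad C by simp
  also have "\<dots> < \<epsilon>" by (rule \<eta>(2))
  finally show ?thesis using that u by blast
qed

end

section \<open>Density of the orbit full group of a dense subgroup\<close>

lemma countable_dense_subgroup:
  fixes H :: "'g::{polish_space, group_add} set"
  assumes H: "is_subgroup H" "closure H = UNIV"
  obtains D where "countable D" "is_subgroup D" "D \<subseteq> H" "closure D = UNIV"
proof -
  obtain C where C: "countable C" "C \<subseteq> H" "H \<subseteq> closure C" using separable by blast
  have sub: "0 \<in> H" "\<And>g h. g \<in> H \<Longrightarrow> h \<in> H \<Longrightarrow> g + h \<in> H" "\<And>g. g \<in> H \<Longrightarrow> - g \<in> H"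
    using H(1) by (auto simp: is_subgroup_def)
  \<comment> \<open>The subgroup generated by \<open>C\<close>, as the set of finite sums of elements and their inverses.\<close>
  define S where "S = C \<union> uminus ` C"
  define D where "D = sum_list ` lists S"
  have "countable D" using C(1) by (simp add: D_def S_def)
  moreover have "is_subgroup D"
    unfolding is_subgroup_def
  proof (intro conjI ballI)
    show "0 \<in> D" unfolding D_def by (rule image_eqI[of _ _ "[]"]) auto
    fix g assume "g \<in> D"
    then obtain xs where xs: "xs \<in> lists S" "g = sum_list xs" by (auto simp: D_def)
    have "- sum_list ys = sum_list (rev (map uminus ys))" for ys :: "'g list"
      by (induction ys) (simp_all add: minus_add)
    moreover have "rev (map uminus xs) \<in> lists S" using xs(1) by (auto simp: S_def lists_eq_set)
    ultimately show "- g \<in> D" using xs(2) by (auto simp: D_def)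
    fix h assume "h \<in> D"
    then obtain ys where ys: "ys \<in> lists S" "h = sum_list ys" by (auto simp: D_def)
    then show "g + h \<in> D" using xs unfolding D_def by (intro image_eqI[of _ _ "xs @ ys"]) auto
  qed
  moreover have "D \<subseteq> H"
  proof -
    have "sum_list xs \<in> H" if "xs \<in> lists S" for xs
      using that C(2) sub by (induction xs) (auto simp: S_def)
    then show ?thesis by (auto simp: D_def)
  qed
  moreover have "closure D = UNIV"
  proof -
    have "c \<in> D" if "c \<in> C" for c
      unfolding D_def by (rule image_eqI[of _ _ "[c]"]) (use that in \<open>auto simp: S_def\<close>)
    then have "closure C \<subseteq> closure D" by (intro closure_mono) blast
    moreover have "closure H \<subseteq> closure C" using C(3) by (simp add: closure_minimal)
    ultimately show ?thesis using H(2) by auto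
  qed
  ultimately show ?thesis by (rule that)
qed

theorem theorem2p3:
  fixes M :: "'x::polish_space measure"
    and act :: "'g::{polish_space, topological_group_add} \<Rightarrow> 'x \<Rightarrow> 'x"
    and d :: "'g \<Rightarrow> 'g \<Rightarrow> real"
    and H :: "'g set"
  assumes "standard_probability_space M"
    and "mp_borel_action M act"
    and "suitable M act"
    and "compatible_right_invariant_bounded_metric d"
    and "is_subgroup H" and "closure H = UNIV"
  shows "convergence_in_measure_topology M act d closure_of orbit_full_group M act H
           = orbit_full_group M act UNIV"
proof -
  have M: "prob_space M" "sets M = sets borel"
    using assms(1) by (auto simp: standard_probability_space_def)
  obtain D where D: "countable D" "is_subgroup D" "D \<subseteq> H" "closure D = UNIV"
    using countable_dense_subgroup[OF assms(5,6)] by metis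
  interpret prob_space M by (rule M(1))
  interpret suitable_action M act D d
    by unfold_locales (use M assms D in auto)
  let ?X = "convergence_in_measure_topology M act d"
  have top: "topspace ?X = orbit_full_group M act UNIV"
    by (rule topspace_convergence_in_measure_topology[OF M(1) assms(4)])
  have L0: "Metric_space (L0 M borel) (L0_dist M d)"
    by (rule Metric_space_L0[OF M(1) assms(4)])
  have "\<tau> \<in> ?X closure_of orbit_full_group M act H" if \<tau>: "\<tau> \<in> orbit_full_group M act UNIV" for \<tau>
    unfolding in_closure_of
  proof (intro conjI allI impI)
    show "\<tau> \<in> topspace ?X" using \<tau> top by simp
    fix U assume U: "\<tau> \<in> U \<and> openin ?X U"
    obtain T where T: "T \<in> \<tau>" "T \<in> mp_bijections M" "\<And>x. \<exists>g. T x = act g x" and "\<tau> \<in> Aut M"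
      using \<tau> by (auto simp: orbit_full_group_def)
    then obtain S where "S \<in> mp_bijections M" "\<tau> = ae_class M M S" by (auto simp: Aut_def)
    then have \<tau>_eq: "\<tau> = ae_class M M T" using T(1) by (simp add: ae_class_eq)
    have T_meas: "T \<in> measurable M M" using T(2) by (simp add: mp_bijections_def)
    obtain f where f: "f \<in> borel_measurable M" "AE x in M. T x = act (f x) x"
      using orbit_lift[OF T_meas T(3)] by blast
    have "move f \<in> ae_class M M T"
      using measurable_move[OF f(1)] f(2) by (auto simp: ae_class_def move_def eq_commute)
    then have Phi_f: "Phi M act (ae_class M borel f) = \<tau>"
      unfolding Phi_ae_class[OF f(1)] \<tau>_eq by (subst ae_class_eq[symmetric]) (auto simp: move_def[abs_def])
    then have f_lift: "ae_class M borel f \<in> lifted_full_group M act"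
      using f(1) \<tau> by (auto simp: lifted_full_group_def L0_def)
    have "openin (lifted_topology M act d) {\<phi> \<in> lifted_full_group M act. Phi M act \<phi> \<in> U}"
      using U by (simp add: openin_convergence_in_measure_topology)
    then obtain W where W: "openin (Metric_space.mtopology (L0 M borel) (L0_dist M d)) W"
        "{\<phi> \<in> lifted_full_group M act. Phi M act \<phi> \<in> U} = W \<inter> lifted_full_group M act"
      unfolding lifted_topology_def openin_subtopology by blast
    have "ae_class M borel f \<in> W" using W(2) f_lift Phi_f U by blast
    then obtain \<epsilon> where \<epsilon>: "0 < \<epsilon>" "Metric_space.mball (L0 M borel) (L0_dist M d) (ae_class M borel f) \<epsilon> \<subseteq> W"
      using W(1) unfolding Metric_space.openin_mtopology[OF L0] by blast
    obtain u where u: "u \<in> borel_measurable M" "range u \<subseteq> D" "move u \<in> mp_bijections M"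
        "(LINT x|M. d (f x) (u x)) < \<epsilon>"
      using approximate_by_subgroup[OF T(2) f \<epsilon>(1)] by metis
    have Phi_u: "Phi M act (ae_class M borel u) = ae_class M M (move u)"
      unfolding Phi_ae_class[OF u(1)] by (simp add: move_def[abs_def])
    have orb: "ae_class M M (move u) \<in> orbit_full_group M act H'" if "D \<subseteq> H'" for H'
    proof -
      have "ae_class M M (move u) \<in> Aut M" using u(3) by (simp add: Aut_def)
      moreover have "move u x \<in> {act k x |k. k \<in> H'}" for x using u(2) that by (auto simp: move_def)
      moreover have "move u \<in> ae_class M M (move u) \<inter> mp_bijections M"
        using u(3) measurable_move[OF u(1)] by (simp add: ae_class_def)
      ultimately show ?thesis unfolding orbit_full_group_def by blast
    qed
    have u_lift: "ae_class M borel u \<in> lifted_full_group M act"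
      using u(1) orb[of UNIV] by (auto simp: lifted_full_group_def L0_def Phi_u)
    have "ae_class M borel u \<in> W"
    proof (rule subsetD[OF \<epsilon>(2)])
      show "ae_class M borel u \<in> Metric_space.mball (L0 M borel) (L0_dist M d) (ae_class M borel f) \<epsilon>"
        unfolding Metric_space.in_mball[OF L0]
        using u(1,4) f(1) by (auto simp: L0_def L0_dist_ae_class[OF Metric_space_d mtopology_d])
    qed
    then have "ae_class M borel u \<in> {\<phi> \<in> lifted_full_group M act. Phi M act \<phi> \<in> U}"
      unfolding W(2) using u_lift by blast
    then have "ae_class M M (move u) \<in> U" unfolding Phi_u[symmetric] by blast
    then show "\<exists>y. y \<in> orbit_full_group M act H \<and> y \<in> U" using orb[OF D(3)] by blast
  qed
  moreover have "?X closure_of orbit_full_group M act H \<subseteq> orbit_full_group M act UNIV"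
    using closure_of_subset_topspace[of ?X] top by simp
  ultimately show ?thesis by blast
qed

end
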